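(* Let $K$ be a commutative ring with identity and let $q\in K$ be invertible. The towers of affine Hecke algebras $$\cdots\longrightarrow H\tilde C_n(q)\xrightarrow{R_n}H\tilde C_{n+1}(q)\longrightarrow\cdots,\qquad \cdots\longrightarrow H\tilde B_n(q)\xrightarrow{Q_n}H\tilde B_{n+1}(q)\longrightarrow\cdots$$ are towers of faithful arrows; that is, $R_n$ is injective for all $n\ge 2$ and $Q_n$ is injective for all $n\ge 3$.
   Context: For $m\ge 2$, $W(\tilde C_m)$ is the Coxeter group with generators $\sigma_0,\sigma_1,\dots,\sigma_{m-1},t_m$, where $\sigma_0\sigma_1$ has order 4, $\sigma_i\sigma_{i+1}$ has order 3 for $1\le i\le m-2$, $\sigma_{m-1}t_m$ has order 4, and all other pairs of distinct generators commute. For $m\ge 3$, $W(\tilde B_m)$ is the Coxeter group with generators $\sigma_1,\sigma_{\bar 1},\sigma_2,\dots,\sigma_{m-1},t_m$, where $\sigma_i\sigma_{i+1}$ has order 3 for $1\le i\le m-2$, $\sigma_{\bar 1}\sigma_2$ has order 3, $\sigma_{m-1}t_m$ has order 4, and all other pairs of distinct generators commute. The Hecke algebra $H\Gamma(q)$ of a Coxeter system $(W(\Gamma),S)$ is the $K$-algebra with $K$-basis $(g_w)_{w\in W(\Gamma)}$ and multiplication determined by, for $s\in S$: $g_sg_w=g_{sw}$ if $l(sw)>l(w)$, and $g_sg_w=q\,g_{sw}+(q-1)g_w$ if $l(sw)<l(w)$, where $l$ is Coxeter length. Since $q$ is invertible each $g_s$ is invertible. The basis elements are written $e_w$ in rank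 $n$ and $g_w$ in rank $n+1$. $R_n:H\tilde C_n(q)\to H\tilde C_{n+1}(q)$ is the $K$-algebra morphism with $e_{\sigma_i}\mapsto g_{\sigma_i}$ for $0\le i\le n-1$ and $e_{t_n}\mapsto g_{\sigma_n}g_{t_{n+1}}g_{\sigma_n}^{-1}$. $Q_n:H\tilde B_n(q)\to H\tilde B_{n+1}(q)$ is the $K$-algebra morphism with $e_\sigma\mapsto g_\sigma$ for $\sigma\in\{\sigma_1,\sigma_{\bar 1},\sigma_2,\dots,\sigma_{n-1}\}$ and $e_{t_n}\mapsto g_{\sigma_n}g_{t_{n+1}}g_{\sigma_n}^{-1}$. *)

theory Defs
  imports "HOL-Algebra.Algebra"
begin

section \<open>Coxeter groups\<close>

text \<open>
  A Coxeter system is given by a set \<open>S\<close> of generators and a Coxeter matrix \<open>m\<close>; \<open>m s t = 0\<close>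
  encodes an infinite entry, that is, no relation between \<open>s\<close> and \<open>t\<close>.  The group is presented as a
  quotient of the monoid of words over \<open>S\<close> by the relations \<open>(s t)^(m s t) = 1\<close>.  When \<open>m s s = 1\<close>, as for
  every Coxeter matrix, these contain \<open>s s = 1\<close>, so inverse letters are not needed and the monoid presentation is the
  usual group presentation.
\<close>

inductive cox_eq :: "'s set \<Rightarrow> ('s \<Rightarrow> 's \<Rightarrow> nat) \<Rightarrow> 's list \<Rightarrow> 's list \<Rightarrow> bool"
  for S :: "'s set" and m :: "'s \<Rightarrow> 's \<Rightarrow> nat"
where
  cox_refl: "u \<in> lists S \<Longrightarrow> cox_eq S m u u"
| cox_sym: "cox_eq S m u v \<Longrightarrow> cox_eq S m v u"
| cox_trans: "cox_eq S m u v \<Longrightarrow> cox_eq S m v w \<Longrightarrow> cox_eq S m u w"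
| cox_rel: "\<lbrakk>u \<in> lists S; v \<in> lists S; s \<in> S; t \<in> S; m s t \<noteq> 0\<rbrakk>
    \<Longrightarrow> cox_eq S m (u @ concat (replicate (m s t) [s, t]) @ v) (u @ v)"

definition cox_class :: "'s set \<Rightarrow> ('s \<Rightarrow> 's \<Rightarrow> nat) \<Rightarrow> 's list \<Rightarrow> 's list set" where
  "cox_class S m u = {v. cox_eq S m u v}"

definition coxeter_group :: "'s set \<Rightarrow> ('s \<Rightarrow> 's \<Rightarrow> nat) \<Rightarrow> 's list set monoid" where
  "coxeter_group S m =
    \<lparr>carrier = cox_class S m ` lists S,
     monoid.mult = (\<lambda>x y. \<Union>u\<in>x. \<Union>v\<in>y. cox_class S m (u @ v)),
     one = cox_class S m []\<rparr>"

abbreviation cox_gen :: "'s set \<Rightarrow> ('s \<Rightarrow> 's \<Rightarrow> nat) \<Rightarrow> 's \<Rightarrow> 's list set" where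
  "cox_gen S m s \<equiv> cox_class S m [s]"

text \<open>A group element is the set of all words representing it, so this is the Coxeter length.\<close>

definition cox_length :: "'s list set \<Rightarrow> nat" where
  "cox_length w = (LEAST k. \<exists>u\<in>w. length u = k)"


section \<open>The groups of types affine C and affine B\<close>

text \<open>\<open>Sig i\<close> stands for \<open>\<sigma>\<^sub>i\<close>, \<open>SigBar\<close> for \<open>\<sigma>\<close> with index 1-bar, and \<open>T m\<close> for \<open>t\<^sub>m\<close>.\<close>

datatype gen = Sig nat | SigBar | T nat

definition C_gens :: "nat \<Rightarrow> gen set" where
  "C_gens m = Sig ` {0..m-1} \<union> {T m}"

definition C_matrix :: "nat \<Rightarrow> gen \<Rightarrow> gen \<Rightarrow> nat" where
  "C_matrix m s t =
    (if s = t then 1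
     else if {s, t} = {Sig 0, Sig 1} then 4
     else if \<exists>i\<in>{1..m-2}. {s, t} = {Sig i, Sig (i+1)} then 3
     else if {s, t} = {Sig (m-1), T m} then 4
     else 2)"

definition B_gens :: "nat \<Rightarrow> gen set" where
  "B_gens m = Sig ` {1..m-1} \<union> {SigBar, T m}"

definition B_matrix :: "nat \<Rightarrow> gen \<Rightarrow> gen \<Rightarrow> nat" where
  "B_matrix m s t =
    (if s = t then 1
     else if \<exists>i\<in>{1..m-2}. {s, t} = {Sig i, Sig (i+1)} then 3
     else if {s, t} = {SigBar, Sig 2} then 3
     else if {s, t} = {Sig (m-1), T m} then 4
     else 2)"


section \<open>Hecke algebras\<close>

text \<open>The library locale \<open>algebra\<close> only covers commutative algebras.\<close>

locale assoc_algebra = module K A + A?: ring A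
  for K (structure) and A (structure) +
  assumes smult_mult_left:
      "\<lbrakk>a \<in> carrier K; x \<in> carrier A; y \<in> carrier A\<rbrakk>
        \<Longrightarrow> (a \<odot>\<^bsub>A\<^esub> x) \<otimes>\<^bsub>A\<^esub> y = a \<odot>\<^bsub>A\<^esub> (x \<otimes>\<^bsub>A\<^esub> y)"
    and smult_mult_right:
      "\<lbrakk>a \<in> carrier K; x \<in> carrier A; y \<in> carrier A\<rbrakk>
        \<Longrightarrow> x \<otimes>\<^bsub>A\<^esub> (a \<odot>\<^bsub>A\<^esub> y) = a \<odot>\<^bsub>A\<^esub> (x \<otimes>\<^bsub>A\<^esub> y)"

definition algebra_hom ::
  "('k, 'p) ring_scheme \<Rightarrow> ('k, 'a, 'q) module_scheme \<Rightarrow> ('k, 'b, 'r) module_scheme \<Rightarrow> ('a \<Rightarrow> 'b) set"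
where
  "algebra_hom K A B =
    {f \<in> ring_hom A B. \<forall>a\<in>carrier K. \<forall>x\<in>carrier A. f (a \<odot>\<^bsub>A\<^esub> x) = a \<odot>\<^bsub>B\<^esub> f x}"

definition is_basis ::
  "('k, 'p) ring_scheme \<Rightarrow> ('k, 'a, 'q) module_scheme \<Rightarrow> 'i set \<Rightarrow> ('i \<Rightarrow> 'a) \<Rightarrow> bool"
where
  "is_basis K M I b \<longleftrightarrow>
    b \<in> I \<rightarrow> carrier M \<and>
    (\<forall>x\<in>carrier M. \<exists>J c. finite J \<and> J \<subseteq> I \<and> c \<in> J \<rightarrow> carrier K \<and>
        x = (\<Oplus>\<^bsub>M\<^esub>i\<in>J. c i \<odot>\<^bsub>M\<^esub> b i)) \<and>
    (\<forall>J c. finite J \<and> J \<subseteq> I \<and> c \<in> J \<rightarrow> carrier K \<and>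
        (\<Oplus>\<^bsub>M\<^esub>i\<in>J. c i \<odot>\<^bsub>M\<^esub> b i) = \<zero>\<^bsub>M\<^esub> \<longrightarrow> (\<forall>i\<in>J. c i = \<zero>\<^bsub>K\<^esub>))"

text \<open>
  \<open>hecke_algebra K H q S m g\<close>: \<open>H\<close> is the Hecke algebra over \<open>K\<close> with parameter \<open>q\<close> of the
  Coxeter system given by \<open>S\<close> and \<open>m\<close>, with standard basis \<open>g\<close>.  These conditions determine \<open>H\<close>
  and \<open>g\<close> up to unique isomorphism.  The normalization \<open>g_one\<close> already follows from the
  other conditions when \<open>S\<close> is nonempty and \<open>q\<close> is invertible.
\<close>

locale hecke_algebra = assoc_algebra K H
  for K :: "('k, 'p) ring_scheme" (structure) and H :: "('k, 'a, 'r) module_scheme" (structure) +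
  fixes q :: 'k and S :: "'s set" and m :: "'s \<Rightarrow> 's \<Rightarrow> nat" and g :: "'s list set \<Rightarrow> 'a"
  assumes q_closed: "q \<in> carrier K"
    and basis: "is_basis K H (carrier (coxeter_group S m)) g"
    and g_one: "g \<one>\<^bsub>coxeter_group S m\<^esub> = \<one>\<^bsub>H\<^esub>"
    and mult_up:
      "\<lbrakk>s \<in> S; w \<in> carrier (coxeter_group S m);
        cox_length (cox_gen S m s \<otimes>\<^bsub>coxeter_group S m\<^esub> w) > cox_length w\<rbrakk>
       \<Longrightarrow> g (cox_gen S m s) \<otimes>\<^bsub>H\<^esub> g w = g (cox_gen S m s \<otimes>\<^bsub>coxeter_group S m\<^esub> w)"
    and mult_down:
      "\<lbrakk>s \<in> S; w \<in> carrier (coxeter_group S m);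
        cox_length (cox_gen S m s \<otimes>\<^bsub>coxeter_group S m\<^esub> w) < cox_length w\<rbrakk>
       \<Longrightarrow> g (cox_gen S m s) \<otimes>\<^bsub>H\<^esub> g w =
            q \<odot>\<^bsub>H\<^esub> g (cox_gen S m s \<otimes>\<^bsub>coxeter_group S m\<^esub> w) \<oplus>\<^bsub>H\<^esub>
            (q \<ominus>\<^bsub>K\<^esub> \<one>\<^bsub>K\<^esub>) \<odot>\<^bsub>H\<^esub> g w"

abbreviation hecke_C ::
  "('k, 'p) ring_scheme \<Rightarrow> 'k \<Rightarrow> nat \<Rightarrow> ('k, 'a) module \<Rightarrow> (gen list set \<Rightarrow> 'a) \<Rightarrow> bool" where
  "hecke_C K q n H e \<equiv> hecke_algebra K H q (C_gens n) (C_matrix n) e"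

abbreviation hecke_B ::
  "('k, 'p) ring_scheme \<Rightarrow> 'k \<Rightarrow> nat \<Rightarrow> ('k, 'a) module \<Rightarrow> (gen list set \<Rightarrow> 'a) \<Rightarrow> bool" where
  "hecke_B K q n H e \<equiv> hecke_algebra K H q (B_gens n) (B_matrix n) e"

abbreviation C_gen :: "nat \<Rightarrow> gen \<Rightarrow> gen list set" where
  "C_gen n \<equiv> cox_gen (C_gens n) (C_matrix n)"

abbreviation B_gen :: "nat \<Rightarrow> gen \<Rightarrow> gen list set" where
  "B_gen n \<equiv> cox_gen (B_gens n) (B_matrix n)"


section \<open>The arrows of the towers\<close>

text \<open>
  \<open>H, e\<close> is the algebra of rank \<open>n\<close> and \<open>H', g\<close> the one of rank \<open>n + 1\<close>.  A morphism is determined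
  on \<open>carrier H\<close> by its values on the generators, so the predicates below pin down \<open>R\<^sub>n\<close> and \<open>Q\<^sub>n\<close>.
\<close>

definition is_R :: "('k, 'p) ring_scheme \<Rightarrow> nat
    \<Rightarrow> ('k, 'a) module \<Rightarrow> (gen list set \<Rightarrow> 'a) \<Rightarrow> ('k, 'b) module \<Rightarrow> (gen list set \<Rightarrow> 'b)
    \<Rightarrow> ('a \<Rightarrow> 'b) \<Rightarrow> bool"
where
  "is_R K n H e H' g R \<longleftrightarrow>
    R \<in> algebra_hom K H H' \<and>
    (\<forall>i\<in>{0..n-1}. R (e (C_gen n (Sig i))) = g (C_gen (n+1) (Sig i))) \<and>
    R (e (C_gen n (T n))) =
      g (C_gen (n+1) (Sig n)) \<otimes>\<^bsub>H'\<^esub> g (C_gen (n+1) (T (n+1)))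
        \<otimes>\<^bsub>H'\<^esub> inv\<^bsub>H'\<^esub> g (C_gen (n+1) (Sig n))"

definition is_Q :: "('k, 'p) ring_scheme \<Rightarrow> nat
    \<Rightarrow> ('k, 'a) module \<Rightarrow> (gen list set \<Rightarrow> 'a) \<Rightarrow> ('k, 'b) module \<Rightarrow> (gen list set \<Rightarrow> 'b)
    \<Rightarrow> ('a \<Rightarrow> 'b) \<Rightarrow> bool"
where
  "is_Q K n H e H' g Q \<longleftrightarrow>
    Q \<in> algebra_hom K H H' \<and>
    (\<forall>s \<in> Sig ` {1..n-1} \<union> {SigBar}. Q (e (B_gen n s)) = g (B_gen (n+1) s)) \<and>
    Q (e (B_gen n (T n))) =
      g (B_gen (n+1) (Sig n)) \<otimes>\<^bsub>H'\<^esub> g (B_gen (n+1) (T (n+1)))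
        \<otimes>\<^bsub>H'\<^esub> inv\<^bsub>H'\<^esub> g (B_gen (n+1) (Sig n))"

end

theory Submission
  imports Defs
begin

text \<open>
  Write \<open>\<phi>\<close> for the substitution on words that replaces \<open>t\<^sub>n\<close> by \<open>\<sigma>\<^sub>n t\<^sub>n\<^sub>+\<^sub>1 \<sigma>\<^sub>n\<close> and keeps the other
  generators.  Since the inverse of a generator \<open>g\<^sub>s\<close> is \<open>q\<inverse> g\<^sub>s + (q\<inverse> - 1)\<close>, the image of \<open>e\<^sub>w\<close> under the
  arrow, for a reduced word \<open>u\<close> of \<open>w\<close>, is a unit times the product of generators along \<open>\<phi> u\<close> plus
  a combination of products along strictly shorter words.  If \<open>\<phi> u\<close> is again reduced, the first product is the
  basis element \<open>g\<^bsub>\<phi>(w)\<^esub>\<close>, and everything else lies in the span of basis elements of smaller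
  length.  If moreover \<open>\<phi>\<close> is injective on the groups, then the images of the \<open>e\<^sub>w\<close> are linearly
  independent: in a vanishing linear combination, a term with \<open>\<phi>(w)\<close> of maximal length contributes
  a coefficient that nothing else can cancel.  This is \<open>hecke_hom_inj_on\<close>, which works over any
  commutative ring, because the leading coefficients are units.

  \<open>\<phi>\<close> preserves reduced words (\<open>reduced_\<phi>\<close>).  A word \<open>s\<^sub>1 \<dots> s\<^sub>k\<close> is reduced if and only if its
  reflections \<open>s\<^sub>1 \<dots> s\<^sub>i \<dots> s\<^sub>1\<close> are distinct.  A letter other than \<open>t\<^sub>n\<close>, with reflection \<open>r\<close>, contributes
  the reflection \<open>\<phi> r\<close> of \<open>\<phi> u\<close>.  A letter \<open>t\<^sub>n\<close> contributes \<open>\<phi> r\<close> and two further reflections \<open>w\<close>,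
  both of which determine \<open>\<phi> r\<close> as \<open>w t\<^sub>n\<^sub>+\<^sub>1 w\<close> and fail to commute with \<open>t\<^sub>n\<^sub>+\<^sub>1\<close>, while \<open>t\<^sub>n\<^sub>+\<^sub>1\<close> commutes
  with the image of \<open>\<phi>\<close>.  So the reflections of \<open>\<phi> u\<close> are distinct as soon as those of \<open>u\<close> are, given
  that \<open>\<phi>\<close> is injective and that \<open>\<sigma>\<^sub>n\<close> and \<open>t\<^sub>n\<^sub>+\<^sub>1\<close> do not commute.

  Both of these facts come from deleting strands (\<open>affine_C_action_strand\<close>).  The group of type affine C
  and rank \<open>n + 1\<close> permutes coordinates up to signs and translations, and forgetting one
  coordinate yields an action of it on pairs of a coordinate \<open>j\<close> and a point of any space on which the
  group of rank \<open>n\<close> acts.  At \<open>j = n + 1\<close>, a word \<open>\<phi> u\<close> acts as \<open>u\<close>, so that \<open>\<phi>\<close> is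
  injective when the chosen action of rank \<open>n\<close> is faithful.  Type affine B is treated inside type
  affine C, with \<open>\<sigma>\<close> of index 1-bar acting as \<open>\<sigma>\<^sub>0 \<sigma>\<^sub>1 \<sigma>\<^sub>0\<close>.
\<close>

section \<open>Words in a Coxeter group\<close>

text \<open>The reflections \<open>s\<^sub>1 \<dots> s\<^sub>i \<dots> s\<^sub>1\<close> attached to the positions of a word \<open>s\<^sub>1 \<dots> s\<^sub>k\<close>.\<close>

fun reflections :: "'s list \<Rightarrow> 's list list" where
  "reflections [] = []"
| "reflections (s # u) = [s] # map (\<lambda>w. s # w @ [s]) (reflections u)"

lemma length_reflections [simp]: "length (reflections u) = length u"
  by (induction u) auto

lemma reflections_append:
  "reflections (u @ v) = reflections u @ map (\<lambda>w. u @ w @ rev u) (reflections v)"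
  by (induction u) (auto simp: comp_def)

lemma in_reflectionsE:
  assumes "w \<in> set (reflections u)"
  obtains b s d where "u = b @ s # d" "w = b @ s # rev b"
  using assms
proof (induction u arbitrary: w thesis)
  case (Cons a u)
  from Cons.prems(2) consider "w = [a]" | w' where "w' \<in> set (reflections u)" "w = a # w' @ [a]"
    by auto
  then show ?case
  proof cases
    case 1
    then show ?thesis using Cons.prems(1)[of "[]" a u] by simp
  next
    case 2
    from Cons.IH[OF _ 2(1)] obtain b s d where "u = b @ s # d" "w' = b @ s # rev b"
      by blast
    then show ?thesis using Cons.prems(1)[of "a # b" s d] 2 by simp
  qed
qed auto

lemma reflections_relator:
  "reflections (concat (replicate k [s, t])) =
    map (\<lambda>i. concat (replicate i [s, t]) @ [s]) [0..<2 * k]"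
proof (induction k)
  case (Suc k)
  have shift: "concat (replicate i [s, t]) @ [s, t] = s # t # concat (replicate i [s, t])" for i
    by (induction i) auto
  have "[0..<2 * Suc k] = 0 # 1 # map (\<lambda>i. Suc (Suc i)) [0..<2 * k]"
    by (rule nth_equalityI) (auto simp: nth_Cons simp del: upt_Suc split: nat.splits)
  moreover have "reflections (concat (replicate (Suc k) [s, t])) =
      [s] # [s, t, s] # map (\<lambda>w. s # t # w @ [t, s]) (reflections (concat (replicate k [s, t])))"
    by (simp add: comp_def)
  ultimately show ?case
    using shift by (simp add: Suc.IH comp_def)
qed simp

lemma count_list_distinct: "\<lbrakk>distinct xs; x \<in> set xs\<rbrakk> \<Longrightarrow> count_list xs x = 1"
  by (induction xs) auto

text \<open>A Coxeter presentation, of whose matrix only the diagonal is restricted.  \<open>E\<close> says that two words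
  represent the same element of the group \<open>W\<close>, and \<open>cl\<close> is the element that a word represents.\<close>

locale coxeter_words =
  fixes S :: "'s set" and m :: "'s \<Rightarrow> 's \<Rightarrow> nat"
  assumes diag: "s \<in> S \<Longrightarrow> m s s = 1"
begin

abbreviation E :: "'s list \<Rightarrow> 's list \<Rightarrow> bool" where "E \<equiv> cox_eq S m"
abbreviation cl :: "'s list \<Rightarrow> 's list set" where "cl \<equiv> cox_class S m"
abbreviation W :: "'s list set monoid" where "W \<equiv> coxeter_group S m"

lemma relator_in_lists: "\<lbrakk>s \<in> S; t \<in> S\<rbrakk> \<Longrightarrow> concat (replicate k [s, t]) \<in> lists S"
  by (induction k) auto

lemma E_lists: "E u v \<Longrightarrow> u \<in> lists S \<and> v \<in> lists S"
  by (induction rule: cox_eq.induct) (use relator_in_lists in auto)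

lemma E_cong:
  assumes "E u v" "a \<in> lists S" "b \<in> lists S"
  shows "E (a @ u @ b) (a @ v @ b)"
  using assms
proof (induction rule: cox_eq.induct)
  case (cox_refl u)
  then show ?case by (intro cox_eq.cox_refl) auto
next
  case (cox_rel u v s t)
  then show ?case
    using cox_eq.cox_rel[of "a @ u" S "v @ b" s t m] by auto
qed (blast intro: cox_eq.intros)+

lemma E_even_length: "E u v \<Longrightarrow> even (length u) = even (length v)"
proof (induction rule: cox_eq.induct)
  case (cox_rel u v s t)
  have "length (concat (replicate k [s, t])) = 2 * k" for k
    by (induction k) auto
  then show ?case by simp
qed auto

lemma cl_eq_iff: "u \<in> lists S \<Longrightarrow> cl u = cl v \<longleftrightarrow> E u v"
  unfolding cox_class_def by (auto intro: cox_eq.intros)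

lemma mult_cl:
  assumes "u \<in> lists S" "v \<in> lists S"
  shows "cl u \<otimes>\<^bsub>W\<^esub> cl v = cl (u @ v)"
proof -
  have same: "cl (u' @ v') = cl (u @ v)" if "u' \<in> cl u" "v' \<in> cl v" for u' v'
  proof -
    have that: "E u u'" "E v v'" using that by (simp_all add: cox_class_def)
    have "E (u @ v) (u' @ v)"
      using E_cong[OF that(1), of "[]" v] assms by auto
    moreover have "E (u' @ v) (u' @ v')"
      using E_cong[OF that(2), of u' "[]"] E_lists[OF that(1)] by auto
    ultimately have "E (u @ v) (u' @ v')"
      by (rule cox_trans)
    then show ?thesis
      using cl_eq_iff[of "u @ v" "u' @ v'"] assms by auto
  qed
  have "u \<in> cl u" "v \<in> cl v"
    using assms by (simp_all add: cox_class_def cox_refl)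
  with same have "(\<Union>u'\<in>cl u. \<Union>v'\<in>cl v. cl (u' @ v')) = cl (u @ v)"
    by blast
  then show ?thesis
    by (simp add: coxeter_group_def)
qed

lemma carrier_W: "carrier W = cl ` lists S"
  and one_W: "\<one>\<^bsub>W\<^esub> = cl []"
  by (simp_all add: coxeter_group_def)

text \<open>The universal property of the presentation: an assignment of functions to generators that
  satisfies the relations gives an action of the group.\<close>

lemma foldr_respects_E:
  assumes rel: "\<And>s t. \<lbrakk>s \<in> S; t \<in> S; m s t \<noteq> 0\<rbrakk> \<Longrightarrow> foldr f (concat (replicate (m s t) [s, t])) = id"
    and "E u v"
  shows "foldr f u = foldr f v"
  using assms(2)
proof (induction rule: cox_eq.induct)
  case (cox_rel u v s t)
  then show ?case by (simp add: rel fun_eq_iff)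
qed auto

text \<open>Left multiplication by a generator on word classes; sets of words that are not classes are
  fixed, so that the relations hold as equations between functions.  A word acts through
  \<^const>\<open>foldr\<close>, and the resulting representation is faithful.\<close>

definition reg :: "'s \<Rightarrow> 's list set \<Rightarrow> 's list set" where
  "reg s Y = (if Y \<in> cl ` lists S then {v \<in> lists S. s # v \<in> Y} else Y)"

abbreviation \<rho> :: "'s list \<Rightarrow> 's list set \<Rightarrow> 's list set" where "\<rho> \<equiv> foldr reg"

lemma E_square: "\<lbrakk>s \<in> S; a \<in> lists S; b \<in> lists S\<rbrakk> \<Longrightarrow> E (a @ s # s # b) (a @ b)"
  using cox_rel[of a S b s s m] diag[of s] by simp

lemma reg_cl:
  assumes "s \<in> S" "w \<in> lists S"
  shows "reg s (cl w) = cl (s # w)"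
proof -
  have "E w (s # v) \<longleftrightarrow> E (s # w) v" if "v \<in> lists S" for v
  proof
    assume "E w (s # v)"
    then have "E (s # w) (s # s # v)"
      using E_cong[of w "s # v" "[s]" "[]"] assms by auto
    with E_square[of s "[]" v] assms that show "E (s # w) v"
      by (auto intro: cox_trans)
  next
    assume "E (s # w) v"
    then have "E (s # s # w) (s # v)"
      using E_cong[of "s # w" v "[s]" "[]"] assms by auto
    with E_square[of s "[]" w] assms show "E w (s # v)"
      by (auto intro: cox_trans cox_sym)
  qed
  moreover have "v \<in> lists S" if "E (s # w) v" for v
    using E_lists that by blast
  ultimately show ?thesis
    using assms unfolding reg_def cox_class_def by auto
qed

lemma \<rho>_cl: "\<lbrakk>u \<in> lists S; w \<in> lists S\<rbrakk> \<Longrightarrow> \<rho> u (cl w) = cl (u @ w)"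
  by (induction u) (auto simp: reg_cl)

lemma \<rho>_not_class: "Y \<notin> cl ` lists S \<Longrightarrow> \<rho> u Y = Y"
  by (induction u) (auto simp: reg_def)

text \<open>Faithfulness, which turns equations between group elements into equations between functions.\<close>

lemma \<rho>_eq_iff:
  assumes "u \<in> lists S" "v \<in> lists S"
  shows "\<rho> u = \<rho> v \<longleftrightarrow> E u v"
proof
  assume "\<rho> u = \<rho> v"
  then have "\<rho> u (cl []) = \<rho> v (cl [])" by simp
  then show "E u v"
    using assms by (simp add: \<rho>_cl cl_eq_iff)
next
  assume uv: "E u v"
  show "\<rho> u = \<rho> v"
  proof
    fix Y
    show "\<rho> u Y = \<rho> v Y"
    proof (cases "Y \<in> cl ` lists S")
      case True
      then obtain w where w: "w \<in> lists S" "Y = cl w" by auto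
      with uv assms show ?thesis
        using E_cong[OF uv, of "[]" w] by (simp add: \<rho>_cl cl_eq_iff)
    qed (simp add: \<rho>_not_class)
  qed
qed

lemma \<rho>_relator:
  assumes "s \<in> S" "t \<in> S" "m s t \<noteq> 0"
  shows "\<rho> (concat (replicate (m s t) [s, t])) = id"
  using \<rho>_eq_iff[of "concat (replicate (m s t) [s, t])" "[]"] cox_rel[of "[]" S "[]" s t m]
    relator_in_lists[OF assms(1,2)] assms by (auto simp: id_def)

lemma reg_square [simp]: "s \<in> S \<Longrightarrow> reg s (reg s Y) = Y"
  using \<rho>_relator[of s s] diag[of s] by (simp add: fun_eq_iff)

lemma reg_order_2:
  assumes "s \<in> S" "t \<in> S" "m s t = 2"
  shows "reg s (reg t Y) = reg t (reg s Y)"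
proof -
  have "(reg s \<circ> reg t \<circ> reg s \<circ> reg t) (reg t (reg s Y)) = reg t (reg s Y)"
    using \<rho>_relator[of s t] assms by (simp add: numeral_eq_Suc comp_assoc del: reg_square)
  then show ?thesis using assms by simp
qed

lemma reg_order_3:
  assumes "s \<in> S" "t \<in> S" "m s t = 3"
  shows "reg s (reg t (reg s Y)) = reg t (reg s (reg t Y))"
proof -
  have "(reg s \<circ> reg t \<circ> reg s \<circ> reg t \<circ> reg s \<circ> reg t) (reg t (reg s (reg t Y))) = reg t (reg s (reg t Y))"
    using \<rho>_relator[of s t] assms by (simp add: numeral_eq_Suc comp_assoc del: reg_square)
  then show ?thesis using assms by simp
qed

lemma reg_order_4:
  assumes "s \<in> S" "t \<in> S" "m s t = 4"
  shows "reg s (reg t (reg s (reg t Y))) = reg t (reg s (reg t (reg s Y)))"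
proof -
  have "(reg s \<circ> reg t \<circ> reg s \<circ> reg t \<circ> reg s \<circ> reg t \<circ> reg s \<circ> reg t) (reg t (reg s (reg t (reg s Y))))
      = reg t (reg s (reg t (reg s Y)))"
    using \<rho>_relator[of s t] assms by (simp add: numeral_eq_Suc comp_assoc del: reg_square)
  then show ?thesis using assms by simp
qed

lemma \<rho>_rev [simp]: "u \<in> lists S \<Longrightarrow> \<rho> (rev u) (\<rho> u Y) = Y"
  and \<rho>_rev' [simp]: "u \<in> lists S \<Longrightarrow> \<rho> u (\<rho> (rev u) Y) = Y"
   by (induction u arbitrary: Y) auto


section \<open>Reflections of a word and reduced words\<close>

lemma reflections_in_lists:
  "\<lbrakk>u \<in> lists S; w \<in> set (reflections u)\<rbrakk> \<Longrightarrow> w \<in> lists S"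
  by (erule in_reflectionsE) auto

text \<open>Each reflection occurs an even number of times in a relator, because the second half of its
  list of reflections repeats the first half.  Hence the parity of the number of occurrences only
  depends on the group element.\<close>

lemma even_count_reflections:
  assumes "E u v"
  shows "even (count_list (map \<rho> (reflections u)) r) = even (count_list (map \<rho> (reflections v)) r)"
  using assms
proof (induction rule: cox_eq.induct)
  case (cox_rel u v s t)
  let ?k = "m s t" and ?x = "concat (replicate (m s t) [s, t])"
  let ?A = "\<lambda>i. concat (replicate i [s, t]) @ [s]"
  have x: "\<rho> ?x = id" using cox_rel \<rho>_relator by blast
  have "?x \<in> lists S" using cox_rel relator_in_lists by blast
  from \<rho>_rev[OF this] x have x': "\<rho> (rev ?x) = id" by (auto simp: fun_eq_iff)
  have "[0..<2 * ?k] = [0..<?k] @ map (\<lambda>i. i + ?k) [0..<?k]"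
    by (rule nth_equalityI) (auto simp: nth_append)
  moreover have "\<rho> (?A (i + ?k)) = \<rho> (?A i)" for i
  proof -
    have "concat (replicate (i + ?k) [s, t]) = concat (replicate i [s, t]) @ ?x"
      by (simp add: replicate_add)
    then show ?thesis by (simp add: x fun_eq_iff del: replicate_add)
  qed
  ultimately have middle: "map (\<lambda>w. \<rho> (u @ w @ rev u)) (reflections ?x) =
      map (\<lambda>i. \<rho> (u @ ?A i @ rev u)) [0..<?k] @ map (\<lambda>i. \<rho> (u @ ?A i @ rev u)) [0..<?k]"
    by (simp add: reflections_relator comp_def fun_eq_iff)
  have whole: "map \<rho> (reflections (u @ ?x @ v)) = map \<rho> (reflections u) @
      map (\<lambda>w. \<rho> (u @ w @ rev u)) (reflections ?x) @ map (\<lambda>w. \<rho> (u @ w @ rev u)) (reflections v)"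
    by (simp add: reflections_append comp_def x x' fun_eq_iff)
  show ?case
    by (simp only: whole middle count_list_append even_add) (simp add: reflections_append comp_def)
qed auto

text \<open>Words of minimal length in their class.\<close>

definition reduced :: "'s list \<Rightarrow> bool" where
  "reduced u \<longleftrightarrow> u \<in> lists S \<and> (\<forall>v. E u v \<longrightarrow> length u \<le> length v)"

text \<open>Distinct reflections occur once, hence oddly often, and so they occur in every word for the same
  group element.\<close>

lemma reduced_if_distinct:
  assumes u: "u \<in> lists S" and d: "distinct (map \<rho> (reflections u))"
  shows "reduced u"
  unfolding reduced_def
proof (intro conjI allI impI)
  fix v assume "E u v"
  have "set (map \<rho> (reflections u)) \<subseteq> set (map \<rho> (reflections v))"
  proof
    fix r assume r: "r \<in> set (map \<rho> (reflections u))"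
    then have "count_list (map \<rho> (reflections u)) r = 1"
      using d count_list_distinct by fast
    then have "odd (count_list (map \<rho> (reflections v)) r)"
      using even_count_reflections[OF \<open>E u v\<close>, of r] by simp
    then show "r \<in> set (map \<rho> (reflections v))"
      by (metis count_list_0_iff even_zero)
  qed
  then have "card (set (map \<rho> (reflections u))) \<le> length (map \<rho> (reflections v))"
    by (meson List.finite_set card_length card_mono order_trans)
  then show "length u \<le> length v"
    using distinct_card[OF d] by simp
qed (use u in auto)

lemma reduced_ConsD:
  assumes "reduced (s # u)"
  shows "reduced u"
  unfolding reduced_def
proof (intro conjI allI impI)
  show u: "u \<in> lists S" using assms by (auto simp: reduced_def)
  fix v assume "E u v"
  then have "E (s # u) (s # v)"
    using E_cong[of u v "[s]" "[]"] assms by (auto simp: reduced_def)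
  then have "length (s # u) \<le> length (s # v)"
    using assms unfolding reduced_def by blast
  then show "length u \<le> length v" by simp
qed

lemma conj_inj:
  assumes "a \<in> lists S" "\<rho> (a @ v @ rev a) = \<rho> (a @ w @ rev a)"
  shows "\<rho> v = \<rho> w"
proof
  fix Y
  from assms(2) have "\<rho> (a @ v @ rev a) (\<rho> a Y) = \<rho> (a @ w @ rev a) (\<rho> a Y)"
    by (rule fun_cong)
  then have "\<rho> a (\<rho> v Y) = \<rho> a (\<rho> w Y)"
    using assms(1) by simp
  then show "\<rho> v Y = \<rho> w Y"
    by (metis assms(1) \<rho>_rev)
qed

lemma distinct_if_reduced:
  assumes "reduced u"
  shows "distinct (map \<rho> (reflections u))"
  using assms
proof (induction u)
  case (Cons s u)
  have s: "s \<in> S" and u: "u \<in> lists S" using Cons.prems by (auto simp: reduced_def)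
  have "distinct (map \<rho> (reflections u))"
    using Cons reduced_ConsD by blast
  moreover have "inj_on (\<lambda>w. \<rho> (s # w @ [s])) (set (reflections u))" if "inj_on \<rho> (set (reflections u))"
  proof (rule inj_onI)
    fix w w'
    assume w: "w \<in> set (reflections u)" "w' \<in> set (reflections u)"
      "\<rho> (s # w @ [s]) = \<rho> (s # w' @ [s])"
    then have "\<rho> w = \<rho> w'" using conj_inj[of "[s]" w w'] s by (simp del: foldr.simps)
    with w(1,2) show "w = w'" using inj_onD[OF that] by blast
  qed
  ultimately have conj_distinct: "distinct (map (\<lambda>w. \<rho> (s # w @ [s])) (reflections u))"
    by (simp add: distinct_map)
  have head: "\<rho> [s] \<noteq> \<rho> (s # w @ [s])" if w: "w \<in> set (reflections u)" for w
  proof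
    assume eq: "\<rho> [s] = \<rho> (s # w @ [s])"
    obtain b a d where ud: "u = b @ a # d" "w = b @ a # rev b"
      using in_reflectionsE[OF w] .
    have bs: "a \<in> S" "b \<in> lists S" "d \<in> lists S" using u ud by auto
    \<comment> \<open>The exchange condition: \<open>b a b\<inverse> = s\<close> lets both \<open>s\<close> and \<open>a\<close> be deleted from \<open>s b a d\<close>.\<close>
    have "\<rho> (s # u) Y = \<rho> (b @ d) Y" for Y
    proof -
      have "\<rho> (s # w @ [s]) (reg s (\<rho> b (\<rho> d Y))) = \<rho> [s] (reg s (\<rho> b (\<rho> d Y)))"
        by (rule fun_cong[OF eq[symmetric]])
      then show ?thesis using ud bs s by simp
    qed
    then have "E (s # u) (b @ d)"
      using \<rho>_eq_iff[of "s # u" "b @ d"] s u bs by auto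
    then have "length (s # u) \<le> length (b @ d)"
      using Cons.prems unfolding reduced_def by blast
    then show False using ud by simp
  qed
  have "\<rho> [s] \<notin> (\<lambda>w. \<rho> (s # w @ [s])) ` set (reflections u)"
    using head by blast
  then show ?case
    using conj_distinct by (simp add: comp_def del: foldr.simps foldr_append)
qed simp

end


section \<open>Replacing a generator by a conjugate keeps words reduced\<close>

text \<open>Two Coxeter systems that share all generators but \<open>t\<close>, which is to be replaced by the conjugate
  \<open>s' \<tau> s'\<close>.  The assumptions on the matrix are the relations needed for \<open>\<tau>\<close> to commute with the image
  of the first system.  The two matrices need not agree on the shared generators.\<close>

locale coxeter_tower = A: coxeter_words S m + B: coxeter_words S' m'
  for S :: "'s set" and m and S' :: "'s set" and m' +
  fixes t s' \<tau> :: 's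
  assumes t: "t \<in> S" and s': "s' \<in> S'" and \<tau>: "\<tau> \<in> S'"
    and old_gens: "s \<in> S - {t} \<Longrightarrow> s \<in> S'"
    and order_2: "s \<in> S - {t} \<Longrightarrow> m' \<tau> s = 2"
    and order_4: "m' s' \<tau> = 4"
begin

text \<open>The substitution, on letters and on words.\<close>

definition expand :: "'s \<Rightarrow> 's list" where
  "expand s = (if s = t then [s', \<tau>, s'] else [s])"

definition \<phi> :: "'s list \<Rightarrow> 's list" where
  "\<phi> u = concat (map expand u)"

lemma \<phi>_simps [simp]: "\<phi> [] = []" "\<phi> (s # u) = expand s @ \<phi> u" "\<phi> (u @ v) = \<phi> u @ \<phi> v"
  by (simp_all add: \<phi>_def)

lemma rev_expand [simp]: "rev (expand s) = expand s"
  by (simp add: expand_def)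

lemma \<phi>_rev: "\<phi> (rev u) = rev (\<phi> u)"
  by (induction u) auto

lemma expand_in_lists: "s \<in> S \<Longrightarrow> expand s \<in> lists S'"
  using old_gens s' \<tau> by (auto simp: expand_def)

lemma \<phi>_in_lists: "u \<in> lists S \<Longrightarrow> \<phi> u \<in> lists S'"
  by (induction u) (use expand_in_lists in auto)

abbreviation (input) "a \<equiv> B.reg s'"
abbreviation (input) "c \<equiv> B.reg \<tau>"

lemmas involutions [simp] = B.reg_square[OF s'] B.reg_square[OF \<tau>]

lemma braid: "a (c (a (c x))) = c (a (c (a x)))"
  using B.reg_order_4[OF s' \<tau> order_4] .

lemma braid_cancel [simp]:
  "a (c (a (c (a x)))) = c (a (c x))"
  "c (a (c (a (c x)))) = a (c (a x))"
  using braid[of "a x"] braid[of "c x"] by simp_all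

lemma c_commutes: "s \<in> S - {t} \<Longrightarrow> c (B.reg s x) = B.reg s (c x)"
  using B.reg_order_2[OF \<tau> old_gens order_2] .

lemma c_commutes_\<phi>: "u \<in> lists S \<Longrightarrow> c (B.\<rho> (\<phi> u) x) = B.\<rho> (\<phi> u) (c x)"
proof (induction u arbitrary: x)
  case (Cons s u)
  then have IH: "c (B.\<rho> (\<phi> u) x) = B.\<rho> (\<phi> u) (c x)" for x by simp
  show ?case
  proof (cases "s = t")
    case True
    then show ?thesis
      using braid[of "B.\<rho> (\<phi> u) x"] by (simp add: expand_def IH)
  next
    case False
    then show ?thesis
      using Cons.prems c_commutes[of s] by (simp add: expand_def IH)
  qed
qed simp

text \<open>\<open>above r w\<close> relates a reflection \<open>r\<close> of a word \<open>u\<close> to the reflections \<open>w\<close> of \<open>\<phi> u\<close> that come from the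
  same letter, all of them written as words.  For \<open>r = b t b\<inverse>\<close> there are three.  Geometrically, \<open>r\<close> is the
  reflection in a wall \<open>x\<^sub>i = k\<close>, which is also the wall of \<open>\<phi> r\<close>, and the two others are the
  reflections in the walls \<open>x\<^sub>i = k \<plusminus> x\<^sub>n\<^sub>+\<^sub>1\<close>.\<close>

definition above :: "'s list \<Rightarrow> 's list \<Rightarrow> bool" where
  "above r w \<longleftrightarrow> w = \<phi> r \<or>
    (\<exists>b \<in> lists S. r = b @ t # rev b \<and>
      (w = \<phi> b @ [s'] @ rev (\<phi> b) \<or> w = \<phi> b @ [s', \<tau>, s', \<tau>, s'] @ rev (\<phi> b)))"

lemma above_conj:
  assumes "above r w" "s \<in> S"
  shows "above (s # r @ [s]) (expand s @ w @ expand s)"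
  using assms(1) unfolding above_def
proof (elim disjE bexE conjE)
  fix b assume b: "b \<in> lists S" "r = b @ t # rev b" and w: "w = \<phi> b @ [s'] @ rev (\<phi> b)"
  then show "expand s @ w @ expand s = \<phi> (s # r @ [s]) \<or>
    (\<exists>b \<in> lists S. s # r @ [s] = b @ t # rev b \<and>
      (expand s @ w @ expand s = \<phi> b @ [s'] @ rev (\<phi> b) \<or>
       expand s @ w @ expand s = \<phi> b @ [s', \<tau>, s', \<tau>, s'] @ rev (\<phi> b)))"
    using assms(2) by (intro disjI2 bexI[of _ "s # b"]) auto
next
  fix b assume b: "b \<in> lists S" "r = b @ t # rev b"
    and w: "w = \<phi> b @ [s', \<tau>, s', \<tau>, s'] @ rev (\<phi> b)"
  then show "expand s @ w @ expand s = \<phi> (s # r @ [s]) \<or>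
    (\<exists>b \<in> lists S. s # r @ [s] = b @ t # rev b \<and>
      (expand s @ w @ expand s = \<phi> b @ [s'] @ rev (\<phi> b) \<or>
       expand s @ w @ expand s = \<phi> b @ [s', \<tau>, s', \<tau>, s'] @ rev (\<phi> b)))"
    using assms(2) by (intro disjI2 bexI[of _ "s # b"]) auto
qed simp

lemma above_generator:
  assumes "w \<in> set (reflections (expand s))"
  shows "above [s] w"
proof (cases "s = t")
  case True
  then have "w = [s'] \<or> w = \<phi> [t] \<or> w = [s', \<tau>, s', \<tau>, s']"
    using assms by (auto simp: expand_def)
  then show ?thesis
    unfolding above_def using True by (auto intro!: bexI[of _ "[]"])
next
  case False
  then show ?thesis using assms by (auto simp: expand_def above_def)
qed

lemma reflections_\<phi>_Cons:
  "reflections (\<phi> (s # u)) =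
    reflections (expand s) @ map (\<lambda>w. expand s @ w @ expand s) (reflections (\<phi> u))"
  by (simp add: reflections_append)

lemma reflection_of_\<phi>:
  assumes "u \<in> lists S" "w \<in> set (reflections (\<phi> u))"
  shows "\<exists>r \<in> set (reflections u). above r w"
  using assms
proof (induction u arbitrary: w rule: list.induct)
  case (Cons s u)
  from Cons.prems(2) consider "w \<in> set (reflections (expand s))"
    | w' where "w' \<in> set (reflections (\<phi> u))" "w = expand s @ w' @ expand s"
    unfolding reflections_\<phi>_Cons by auto
  then show ?case
  proof cases
    case 1
    then show ?thesis using above_generator by auto
  next
    case 2
    show ?thesis
    proof -
      obtain r where r: "r \<in> set (reflections u)" "above r w'"
        using Cons.IH[OF _ 2(1)] Cons.prems(1) by auto
      then have "above (s # r @ [s]) w"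
        using above_conj[OF r(2)] Cons.prems(1) 2(2) by auto
      then show ?thesis
        using r(1) by auto
    qed
  qed
qed simp

end

text \<open>Injectivity of \<open>\<phi>\<close> is stated on words; \<open>\<phi>\<close> is not assumed to be well defined on group
  elements.\<close>

locale faithful_coxeter_tower = coxeter_tower S m S' m' t s' \<tau>
  for S :: "'s set" and m and S' :: "'s set" and m' and t s' \<tau> :: 's +
  assumes \<phi>_inj: "\<lbrakk>u \<in> lists S; v \<in> lists S; cox_eq S' m' (\<phi> u) (\<phi> v)\<rbrakk> \<Longrightarrow> cox_eq S m u v"
    and not_commute: "\<not> cox_eq S' m' [s', \<tau>] [\<tau>, s']"
begin

lemma not_commute': "\<not> (\<forall>x. a (c x) = c (a x))"
  using not_commute B.\<rho>_eq_iff[of "[s', \<tau>]" "[\<tau>, s']"] s' \<tau> by (auto simp: fun_eq_iff)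

text \<open>\<open>\<tau>\<close> separates the two kinds of reflections: it commutes with the image of \<open>\<phi>\<close>, but not with
  the extra reflections, and an extra reflection \<open>w\<close> above \<open>r\<close> satisfies \<open>w \<tau> w = \<phi> r\<close>.\<close>

lemma above_cases:
  assumes "above r w"
  obtains "w = \<phi> r"
  | "\<And>x. B.\<rho> w (c (B.\<rho> w x)) = B.\<rho> (\<phi> r) x" "\<not> (\<forall>x. c (B.\<rho> w x) = B.\<rho> w (c x))"
proof (cases "w = \<phi> r")
  case False
  with assms obtain b where b: "b \<in> lists S" "r = b @ t # rev b" and
    w: "w = \<phi> b @ [s'] @ rev (\<phi> b) \<or> w = \<phi> b @ [s', \<tau>, s', \<tau>, s'] @ rev (\<phi> b)"
    unfolding above_def by blast
  note [simp] = c_commutes_\<phi>[OF b(1)] B.\<rho>_rev[OF \<phi>_in_lists[OF b(1)]] B.\<rho>_rev'[OF \<phi>_in_lists[OF b(1)]]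
  have *: "B.\<rho> w (c (B.\<rho> w x)) = B.\<rho> (\<phi> r) x" for x
    using w b by (auto simp: expand_def \<phi>_rev)
  have **: "B.\<rho> w (B.\<rho> w x) = x" for x
    using w by auto
  have "\<not> (\<forall>x. c (B.\<rho> w x) = B.\<rho> w (c x))"
  proof
    assume "\<forall>x. c (B.\<rho> w x) = B.\<rho> w (c x)"
    with * ** have eq: "B.\<rho> (\<phi> r) x = c x" for x by metis
    have "a (c (a x)) = c x" for x
    proof -
      have "B.\<rho> (\<phi> b) (a (c (a x))) = B.\<rho> (\<phi> b) (c x)"
        using eq[of "B.\<rho> (\<phi> b) x"] b by (simp add: expand_def \<phi>_rev)
      then show ?thesis
        by (metis B.\<rho>_rev[OF \<phi>_in_lists[OF b(1)]])
    qed
    then have "a (c x) = c (a x)" for x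
      by (metis involutions(1))
    with not_commute' show False by blast
  qed
  with * that(2) show ?thesis by blast
qed (use that in blast)

lemma above_unique:
  assumes "above r w" "above r' w'" "B.\<rho> w = B.\<rho> w'" "r \<in> lists S" "r' \<in> lists S"
  shows "A.\<rho> r = A.\<rho> r'"
proof -
  note comm = c_commutes_\<phi>[OF assms(4)] c_commutes_\<phi>[OF assms(5)]
  have "B.\<rho> (\<phi> r) = B.\<rho> (\<phi> r')"
    using assms(1)
  proof (cases rule: above_cases)
    case 1
    note w = this
    from assms(2) show ?thesis
    proof (cases rule: above_cases)
      case 1
      then show ?thesis using w assms(3) by simp
    next
      case 2
      with w comm assms(3) show ?thesis by metis
    qed
  next
    case 2
    note w = this
    from assms(2) show ?thesis
    proof (cases rule: above_cases)
      case 1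
      with w comm assms(3) show ?thesis by metis
    next
      case 2
      show ?thesis
      proof
        fix x
        show "B.\<rho> (\<phi> r) x = B.\<rho> (\<phi> r') x"
          using w(1)[of x] 2(1)[of x] assms(3) by metis
      qed
    qed
  qed
  then show ?thesis
    using assms(4,5) \<phi>_inj \<phi>_in_lists A.\<rho>_eq_iff B.\<rho>_eq_iff by metis
qed

lemma distinct_reflections_expand:
  assumes "s \<in> S"
  shows "distinct (map B.\<rho> (reflections (expand s)))"
proof (cases "s = t")
  case True
  have 1: "B.reg s' \<noteq> B.\<rho> [s', \<tau>, s']"
  proof
    assume eq: "B.reg s' = B.\<rho> [s', \<tau>, s']"
    have "a x = a (c (a x))" for x
      by (rule trans[OF fun_cong[OF eq]]) simp
    then have "a (c x) = x" for x
      by (metis involutions(1))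
    then have "a x = c x" for x
      by (metis involutions(1))
    with not_commute' show False by metis
  qed
  have 2: "B.reg s' \<noteq> B.\<rho> [s', \<tau>, s', \<tau>, s']"
  proof
    assume eq: "B.reg s' = B.\<rho> [s', \<tau>, s', \<tau>, s']"
    have "a x = c (a (c x))" for x
      by (rule trans[OF fun_cong[OF eq]]) simp
    with not_commute' show False by (metis involutions(2))
  qed
  have 3: "B.\<rho> [s', \<tau>, s'] \<noteq> B.\<rho> [s', \<tau>, s', \<tau>, s']"
  proof
    assume eq: "B.\<rho> [s', \<tau>, s'] = B.\<rho> [s', \<tau>, s', \<tau>, s']"
    have aca: "a (c (a x)) = c (a (c x))" for x
      using fun_cong[OF eq, of x] by simp
    have "a (c x) = c (a x)" for x
    proof -
      have "a (c (a (c x))) = a (a (c (a x)))"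
        by (rule arg_cong[OF aca[symmetric]])
      moreover have "c (a (c (a x))) = c (c (a (c x)))"
        by (rule arg_cong[OF aca])
      ultimately show ?thesis
        using braid[of x] by (simp only: involutions)
    qed
    with not_commute' show False by blast
  qed
  show ?thesis using True 1 2 3 by (simp add: expand_def)
qed (simp add: expand_def)

lemma distinct_reflections_\<phi>:
  assumes "u \<in> lists S" "distinct (map A.\<rho> (reflections u))"
  shows "distinct (map B.\<rho> (reflections (\<phi> u)))"
  using assms
proof (induction u rule: list.induct)
  case (Cons s u)
  let ?conj = "\<lambda>w. expand s @ w @ expand s"
  have s: "s \<in> S" and u: "u \<in> lists S" using Cons.prems by auto
  have conj_A: "A.\<rho> (s # v @ [s]) = A.\<rho> (s # w @ [s])" if "A.\<rho> v = A.\<rho> w" for v w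
    using that by (simp add: fun_eq_iff)
  have d: "distinct (map A.\<rho> (map (\<lambda>w. s # w @ [s]) (reflections u)))"
    and head: "A.\<rho> [s] \<notin> A.\<rho> ` (\<lambda>w. s # w @ [s]) ` set (reflections u)"
    using Cons.prems(2) by (auto simp: image_image simp del: foldr.simps foldr_append)
  have "distinct (map A.\<rho> (reflections u))"
    unfolding distinct_map
  proof (intro conjI inj_onI)
    show "distinct (reflections u)"
      using d by (simp only: distinct_map)
    fix v w assume vw: "v \<in> set (reflections u)" "w \<in> set (reflections u)" "A.\<rho> v = A.\<rho> w"
    have "inj_on (\<lambda>w. A.\<rho> (s # w @ [s])) (set (reflections u))"
      using d unfolding map_map by (simp only: distinct_map comp_def)
    from inj_onD[OF this conj_A[OF vw(3)] vw(1,2)] show "v = w" .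
  qed
  then have IH: "distinct (map B.\<rho> (reflections (\<phi> u)))"
    using Cons.IH u by blast
  have "inj_on B.\<rho> (?conj ` set (reflections (\<phi> u)))"
  proof (rule inj_onI)
    fix v w assume "v \<in> ?conj ` set (reflections (\<phi> u))" "w \<in> ?conj ` set (reflections (\<phi> u))"
      and eq: "B.\<rho> v = B.\<rho> w"
    then obtain v' w' where vw: "v' \<in> set (reflections (\<phi> u))" "v = ?conj v'"
      "w' \<in> set (reflections (\<phi> u))" "w = ?conj w'" by blast
    then have "B.\<rho> v' = B.\<rho> w'"
      using B.conj_inj[OF expand_in_lists[OF s], of v' w'] eq by simp
    then show "v = w" using IH vw unfolding distinct_map inj_on_def by blast
  qed
  moreover have "distinct (map ?conj (reflections (\<phi> u)))"
    using IH unfolding distinct_map by (simp add: inj_on_def)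
  ultimately have "distinct (map B.\<rho> (map ?conj (reflections (\<phi> u))))"
    unfolding distinct_map[of B.\<rho>] by simp
  moreover have "B.\<rho> v \<noteq> B.\<rho> w"
    if v: "v \<in> set (reflections (expand s))" and w: "w \<in> ?conj ` set (reflections (\<phi> u))" for v w
  proof
    assume eq: "B.\<rho> v = B.\<rho> w"
    from w obtain w' where w': "w' \<in> set (reflections (\<phi> u))" "w = ?conj w'" by blast
    then obtain r where r: "r \<in> set (reflections u)" "above r w'"
      using reflection_of_\<phi>[OF u] by blast
    have "r \<in> lists S" using A.reflections_in_lists[OF u r(1)] .
    then have "A.\<rho> [s] = A.\<rho> (s # r @ [s])"
      using above_unique[OF above_generator[OF v] above_conj[OF r(2) s]] eq w' s by simp
    then show False using head r(1) by blast
  qed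
  ultimately show ?case
    unfolding reflections_\<phi>_Cons map_append distinct_append
    using distinct_reflections_expand[OF s] by auto
qed simp

lemma reduced_\<phi>: "A.reduced u \<Longrightarrow> B.reduced (\<phi> u)"
  using B.reduced_if_distinct distinct_reflections_\<phi> A.distinct_if_reduced \<phi>_in_lists
  by (auto simp: A.reduced_def)

end


section \<open>Deleting a strand\<close>

text \<open>Functions that satisfy the relations of type affine C in braid form, with \<open>p i\<close> for \<open>\<sigma>\<^sub>i\<close> and \<open>pt\<close>
  for \<open>t\<^sub>n\<close>.\<close>

locale affine_C_action =
  fixes n :: nat and p :: "nat \<Rightarrow> 'x \<Rightarrow> 'x" and pt :: "'x \<Rightarrow> 'x"
  assumes n: "2 \<le> n"
    and square: "i < n \<Longrightarrow> p i (p i x) = x"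
    and square_t: "pt (pt x) = x"
    and braid_01: "p 0 (p 1 (p 0 (p 1 x))) = p 1 (p 0 (p 1 (p 0 x)))"
    and braid: "\<lbrakk>1 \<le> i; i + 1 < n\<rbrakk> \<Longrightarrow> p i (p (i + 1) (p i x)) = p (i + 1) (p i (p (i + 1) x))"
    and braid_t: "p (n - 1) (pt (p (n - 1) (pt x))) = pt (p (n - 1) (pt (p (n - 1) x)))"
    and commute: "\<lbrakk>i + 1 < k; k < n\<rbrakk> \<Longrightarrow> p i (p k x) = p k (p i x)"
    and commute_t: "i + 1 < n \<Longrightarrow> p i (pt x) = pt (p i x)"

text \<open>The action of rank \<open>n + 1\<close> obtained from one of rank \<open>n\<close>.  In a pair \<open>(j, x)\<close> the strand \<open>j\<close>, between \<open>1\<close>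
  and \<open>n + 1\<close>, is the deleted coordinate.  A generator that moves strand \<open>j\<close> only changes \<open>j\<close>; any
  other one acts on \<open>x\<close> as the generator that it becomes when the remaining strands are
  renumbered.  \<open>\<sigma>\<^sub>0\<close> reverses strand \<open>1\<close> and \<open>t\<^sub>n\<^sub>+\<^sub>1\<close> strand \<open>n + 1\<close>, which is invisible if that strand is
  deleted.  Pairs with \<open>j\<close> out of range are fixed.\<close>

definition strand :: "nat \<Rightarrow> (nat \<Rightarrow> 'x \<Rightarrow> 'x) \<Rightarrow> nat \<Rightarrow> nat \<times> 'x \<Rightarrow> nat \<times> 'x" where
  "strand n p i = (\<lambda>(j, x).
    if j = 0 \<or> n + 1 < j then (j, x)
    else if j = i then (i + 1, x)
    else if j = i + 1 then (if i = 0 then j else i, x)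
    else (j, p (if j < i then i - 1 else i) x))"

definition strand_t :: "nat \<Rightarrow> ('x \<Rightarrow> 'x) \<Rightarrow> nat \<times> 'x \<Rightarrow> nat \<times> 'x" where
  "strand_t n pt = (\<lambda>(j, x). (j, if j = 0 \<or> n < j then x else pt x))"

lemma (in affine_C_action) affine_C_action_strand:
  "affine_C_action (n + 1) (strand n p) (strand_t n pt)"
proof
  show "2 \<le> n + 1" using n by simp
next
  fix i :: nat and y :: "nat \<times> 'x" assume i: "i < n + 1"
  obtain j x where y: "y = (j, x)" by fastforce
  show "strand n p i (strand n p i y) = y"
    using i square[of i x] square[of "i - 1" x] by (auto simp: y strand_def)
next
  fix y :: "nat \<times> 'x"
  obtain j x where y: "y = (j, x)" by fastforce
  show "strand_t n pt (strand_t n pt y) = y"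
    by (simp add: y strand_t_def square_t)
next
  fix y :: "nat \<times> 'x"
  obtain j x where y: "y = (j, x)" by fastforce
  consider "j = 0 \<or> n + 1 < j" | "j = 1" | "j = 2" | "2 < j" "j \<le> n + 1" by linarith
  then show "strand n p 0 (strand n p 1 (strand n p 0 (strand n p 1 y))) =
      strand n p 1 (strand n p 0 (strand n p 1 (strand n p 0 y)))"
    by cases (use n braid_01[of x] in \<open>simp_all add: y strand_def\<close>)
next
  fix i :: nat and y :: "nat \<times> 'x" assume i: "1 \<le> i" "i + 1 < n + 1"
  obtain j x where y: "y = (j, x)" by fastforce
  consider "j = 0 \<or> n + 1 < j" | "1 \<le> j" "j < i" | "j = i" | "j = i + 1" | "j = i + 2"
    | "i + 2 < j" "j \<le> n + 1" by linarith
  then show "strand n p i (strand n p (i + 1) (strand n p i y)) =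
      strand n p (i + 1) (strand n p i (strand n p (i + 1) y))"
    by cases (use i braid[of i x] braid[of "i - 1" x] in \<open>simp_all add: y strand_def\<close>)
next
  fix y :: "nat \<times> 'x"
  obtain j x where y: "y = (j, x)" by fastforce
  consider "j = 0 \<or> n + 1 < j" | "1 \<le> j" "j < n" | "j = n" | "j = n + 1" by linarith
  then show "strand n p (n + 1 - 1) (strand_t n pt (strand n p (n + 1 - 1) (strand_t n pt y))) =
      strand_t n pt (strand n p (n + 1 - 1) (strand_t n pt (strand n p (n + 1 - 1) y)))"
    by cases (use n braid_t[of x] in \<open>simp_all add: y strand_def strand_t_def\<close>)
next
  fix i k :: nat and y :: "nat \<times> 'x" assume ik: "i + 1 < k" "k < n + 1"
  obtain j x where y: "y = (j, x)" by fastforce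
  consider "j = 0 \<or> n + 1 < j" | "1 \<le> j" "j < i" | "1 \<le> j" "j = i" | "j = i + 1" | "i + 1 < j" "j < k"
    | "j = k" | "j = k + 1" | "k + 1 < j" "j \<le> n + 1" by linarith
  then show "strand n p i (strand n p k y) = strand n p k (strand n p i y)"
    by cases (use ik commute[of i k x] commute[of "i - 1" "k - 1" x] commute[of i "k - 1" x]
      in \<open>simp_all add: y strand_def\<close>)
next
  fix i :: nat and y :: "nat \<times> 'x" assume i: "i + 1 < n + 1"
  obtain j x where y: "y = (j, x)" by fastforce
  consider "j = 0 \<or> n + 1 < j" | "1 \<le> j" "j < i" | "1 \<le> j" "j = i" | "j = i + 1" | "i + 1 < j" "j \<le> n"
    | "j = n + 1" by linarith
  then show "strand n p i (strand_t n pt y) = strand_t n pt (strand n p i y)"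
    by cases (use i commute_t[of i x] commute_t[of "i - 1" x]
      in \<open>simp_all add: y strand_def strand_t_def\<close>)
qed

section \<open>Actions of the groups of types affine C and affine B\<close>

text \<open>The action of all generators of types affine B and affine C; the index of the generator \<open>T\<close> is
  immaterial.\<close>

fun gen_act :: "(nat \<Rightarrow> 'x \<Rightarrow> 'x) \<Rightarrow> ('x \<Rightarrow> 'x) \<Rightarrow> gen \<Rightarrow> 'x \<Rightarrow> 'x" where
  "gen_act p pt (Sig i) = p i"
| "gen_act p pt SigBar = p 0 \<circ> p 1 \<circ> p 0"
| "gen_act p pt (T k) = pt"

lemma relator_if_square:
  assumes "\<And>x. f s (f s x) = x"
  shows "foldr f (concat (replicate 1 [s, s])) = id"
  using assms by (simp add: fun_eq_iff)

lemma relator_if_commute: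
  assumes "\<And>x. f s (f s x) = x" "\<And>x. f t (f t x) = x" "\<And>x. f s (f t x) = f t (f s x)"
  shows "foldr f (concat (replicate 2 [s, t])) = id" "foldr f (concat (replicate 2 [t, s])) = id"
  using assms by (simp_all add: fun_eq_iff numeral_eq_Suc)

lemma relator_if_braid_3:
  assumes "\<And>x. f s (f s x) = x" "\<And>x. f t (f t x) = x"
    "\<And>x. f s (f t (f s x)) = f t (f s (f t x))"
  shows "foldr f (concat (replicate 3 [s, t])) = id" "foldr f (concat (replicate 3 [t, s])) = id"
  using assms by (simp_all add: fun_eq_iff numeral_eq_Suc)

lemma relator_if_braid_4:
  assumes "\<And>x. f s (f s x) = x" "\<And>x. f t (f t x) = x"
    "\<And>x. f s (f t (f s (f t x))) = f t (f s (f t (f s x)))"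
  shows "foldr f (concat (replicate 4 [s, t])) = id" "foldr f (concat (replicate 4 [t, s])) = id"
  using assms by (simp_all add: fun_eq_iff numeral_eq_Suc)

context affine_C_action
begin

abbreviation act :: "gen \<Rightarrow> 'x \<Rightarrow> 'x" where "act \<equiv> gen_act p pt"

lemma act_square_C: "s \<in> C_gens n \<Longrightarrow> act s (act s x) = x"
  using n by (auto simp: C_gens_def square square_t)

lemma act_relator_C_Sig:
  assumes "i < k" "k < n"
  shows "foldr act (concat (replicate (C_matrix n (Sig i) (Sig k)) [Sig i, Sig k])) = id"
    "foldr act (concat (replicate (C_matrix n (Sig k) (Sig i)) [Sig k, Sig i])) = id"
proof -
  have sq: "act (Sig i) (act (Sig i) x) = x" "act (Sig k) (act (Sig k) x) = x" for x
    using assms square by simp_all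
  consider "i = 0" "k = 1" | "1 \<le> i" "k = i + 1" | "i + 1 < k" using assms by linarith
  then have "foldr act (concat (replicate (C_matrix n (Sig i) (Sig k)) [Sig i, Sig k])) = id \<and>
    foldr act (concat (replicate (C_matrix n (Sig k) (Sig i)) [Sig k, Sig i])) = id"
  proof cases
    case 1
    then have "C_matrix n (Sig i) (Sig k) = 4" "C_matrix n (Sig k) (Sig i) = 4"
      by (auto simp: C_matrix_def doubleton_eq_iff)
    then show ?thesis
      using relator_if_braid_4[of act "Sig i" "Sig k"] sq braid_01 1 by simp
  next
    case 2
    then have "C_matrix n (Sig i) (Sig k) = 3" "C_matrix n (Sig k) (Sig i) = 3"
      using assms by (auto simp: C_matrix_def doubleton_eq_iff)
    then show ?thesis
      using relator_if_braid_3[of act "Sig i" "Sig k"] sq braid[of i] 2 assms by simp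
  next
    case 3
    then have "C_matrix n (Sig i) (Sig k) = 2" "C_matrix n (Sig k) (Sig i) = 2"
      by (auto simp: C_matrix_def doubleton_eq_iff)
    then show ?thesis
      using relator_if_commute[of act "Sig i" "Sig k"] sq commute[of i k] 3 assms by simp
  qed
  then show "foldr act (concat (replicate (C_matrix n (Sig i) (Sig k)) [Sig i, Sig k])) = id"
    "foldr act (concat (replicate (C_matrix n (Sig k) (Sig i)) [Sig k, Sig i])) = id" by auto
qed

lemma act_relator_C_T:
  assumes "i < n"
  shows "foldr act (concat (replicate (C_matrix n (Sig i) (T n)) [Sig i, T n])) = id"
    "foldr act (concat (replicate (C_matrix n (T n) (Sig i)) [T n, Sig i])) = id"
proof -
  have sq: "act (Sig i) (act (Sig i) x) = x" "act (T n) (act (T n) x) = x" for x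
    using assms square square_t by simp_all
  consider "i = n - 1" | "i + 1 < n" using assms by linarith
  then have "foldr act (concat (replicate (C_matrix n (Sig i) (T n)) [Sig i, T n])) = id \<and>
    foldr act (concat (replicate (C_matrix n (T n) (Sig i)) [T n, Sig i])) = id"
  proof cases
    case 1
    then have "C_matrix n (Sig i) (T n) = 4" "C_matrix n (T n) (Sig i) = 4"
      by (auto simp: C_matrix_def doubleton_eq_iff)
    then show ?thesis
      using relator_if_braid_4[of act "Sig i" "T n"] sq braid_t 1 by simp
  next
    case 2
    then have "C_matrix n (Sig i) (T n) = 2" "C_matrix n (T n) (Sig i) = 2"
      by (auto simp: C_matrix_def doubleton_eq_iff)
    then show ?thesis
      using relator_if_commute[of act "Sig i" "T n"] sq commute_t[of i] 2 by simp
  qed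
  then show "foldr act (concat (replicate (C_matrix n (Sig i) (T n)) [Sig i, T n])) = id"
    "foldr act (concat (replicate (C_matrix n (T n) (Sig i)) [T n, Sig i])) = id" by auto
qed

lemma act_relator_C:
  assumes "s \<in> C_gens n" "t \<in> C_gens n"
  shows "foldr act (concat (replicate (C_matrix n s t) [s, t])) = id"
proof (cases "s = t")
  case True
  then show ?thesis
    using relator_if_square[of act s] act_square_C assms by (simp add: C_matrix_def)
next
  case False
  have gen: "(\<exists>i<n. u = Sig i) \<or> u = T n" if "u \<in> C_gens n" for u
    using that n by (auto simp: C_gens_def)
  from gen[OF assms(1)] gen[OF assms(2)] False show ?thesis
    by (elim disjE exE conjE)
      (metis act_relator_C_Sig act_relator_C_T nat_neq_iff)+
qed

end


context affine_C_action
begin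

lemma bar_square: "act SigBar (act SigBar x) = x"
  using n square by simp

lemma bar_1: "act SigBar (act (Sig 1) x) = act (Sig 1) (act SigBar x)"
  using braid_01 by simp

lemma bar_2: "3 \<le> n \<Longrightarrow> act SigBar (act (Sig 2) (act SigBar x)) = act (Sig 2) (act SigBar (act (Sig 2) x))"
  using commute[of 0 2] braid[of 1] square[of 0] by (simp add: numeral_2_eq_2)

lemma bar_commute: "\<lbrakk>3 \<le> i; i < n\<rbrakk> \<Longrightarrow> act SigBar (act (Sig i) x) = act (Sig i) (act SigBar x)"
  using commute[of 0 i] commute[of 1 i] by simp

lemma bar_commute_t: "3 \<le> n \<Longrightarrow> act SigBar (act (T n) x) = act (T n) (act SigBar x)"
  using commute_t[of 0] commute_t[of 1] by simp

text \<open>Conjugating \<open>\<sigma>\<^sub>1\<close> by \<open>\<sigma>\<^sub>0\<close> turns an action of the group of type affine C into one of the group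
  of type affine B.\<close>

lemma act_relator_B_bar:
  assumes n3: "3 \<le> n" and s: "s \<in> B_gens n"
  shows "foldr act (concat (replicate (B_matrix n SigBar s) [SigBar, s])) = id \<and>
    foldr act (concat (replicate (B_matrix n s SigBar) [s, SigBar])) = id"
proof -
  have "s = SigBar \<or> s = T n \<or> s = Sig 1 \<or> s = Sig 2 \<or> (\<exists>i. s = Sig i \<and> 3 \<le> i \<and> i < n)"
  proof (cases s)
    case (Sig i)
    then have "1 \<le> i" "i < n" using s n3 by (auto simp: B_gens_def)
    moreover from this have "i = 1 \<or> i = 2 \<or> 3 \<le> i" by linarith
    ultimately show ?thesis using Sig by blast
  qed (use s in \<open>auto simp: B_gens_def\<close>)
  then consider "s = SigBar" | "s = T n" | "s = Sig 1" | "s = Sig 2" | i where "s = Sig i" "3 \<le> i" "i < n"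
    by blast
  then show ?thesis
  proof cases
    case 1
    then show ?thesis
      using relator_if_square[of act SigBar] bar_square by (simp add: B_matrix_def)
  next
    case 2
    then have "B_matrix n SigBar s = 2" "B_matrix n s SigBar = 2"
      by (auto simp: B_matrix_def doubleton_eq_iff)
    then show ?thesis
      using relator_if_commute[of act SigBar s] bar_square bar_commute_t[OF n3] square_t 2
      by (simp del: gen_act.simps(2))
  next
    case 3
    then have "B_matrix n SigBar s = 2" "B_matrix n s SigBar = 2"
      by (auto simp: B_matrix_def doubleton_eq_iff)
    then show ?thesis
      using relator_if_commute[of act SigBar s] bar_square bar_1 square[of 1] n3 3
      by (simp del: gen_act.simps(2))
  next
    case 4
    then have "B_matrix n SigBar s = 3" "B_matrix n s SigBar = 3"
      by (auto simp: B_matrix_def doubleton_eq_iff)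
    then show ?thesis
      using relator_if_braid_3[of act SigBar s] bar_square bar_2[OF n3] square[of 2] n3 4
      by (simp del: gen_act.simps(2))
  next
    case 5
    then have "B_matrix n SigBar s = 2" "B_matrix n s SigBar = 2"
      by (auto simp: B_matrix_def doubleton_eq_iff)
    then show ?thesis
      using relator_if_commute[of act SigBar s] bar_square bar_commute[of i] square[of i] 5
      by (simp del: gen_act.simps(2))
  qed
qed

lemma B_matrix_eq_C_matrix:
  assumes "s \<in> B_gens n" "t \<in> B_gens n" "s \<noteq> SigBar" "t \<noteq> SigBar"
  shows "B_matrix n s t = C_matrix n s t" "s \<in> C_gens n" "t \<in> C_gens n"
proof -
  have "{s, t} \<noteq> {Sig 0, Sig 1}" "{s, t} \<noteq> {SigBar, Sig 2}"
    using assms by (auto simp: doubleton_eq_iff B_gens_def)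
  then show "B_matrix n s t = C_matrix n s t"
    by (simp add: B_matrix_def C_matrix_def)
  show "s \<in> C_gens n" "t \<in> C_gens n"
    using assms by (auto simp: C_gens_def B_gens_def)
qed

lemma act_relator_B:
  assumes "3 \<le> n" "s \<in> B_gens n" "t \<in> B_gens n"
  shows "foldr act (concat (replicate (B_matrix n s t) [s, t])) = id"
  using act_relator_B_bar[OF assms(1,2)] act_relator_B_bar[OF assms(1,3)]
    B_matrix_eq_C_matrix[OF assms(2,3)] act_relator_C[of s t]
  by (cases "s = SigBar"; cases "t = SigBar") (simp_all del: gen_act.simps)

end

lemma coxeter_words_C: "coxeter_words (C_gens n) (C_matrix n)"
  and coxeter_words_B: "coxeter_words (B_gens n) (B_matrix n)"
  by (simp_all add: coxeter_words_def C_matrix_def B_matrix_def)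

lemma affine_C_action_reg:
  assumes n: "2 \<le> n"
  shows "affine_C_action n (\<lambda>i. coxeter_words.reg (C_gens n) (C_matrix n) (Sig i))
    (coxeter_words.reg (C_gens n) (C_matrix n) (T n))"
proof -
  interpret coxeter_words "C_gens n" "C_matrix n" by (rule coxeter_words_C)
  have gens: "Sig i \<in> C_gens n" if "i < n" for i
    using that by (auto simp: C_gens_def)
  have t: "T n \<in> C_gens n" by (simp add: C_gens_def)
  show ?thesis
  proof
    show "reg (Sig i) (reg (Sig k) x) = reg (Sig k) (reg (Sig i) x)" if "i + 1 < k" "k < n" for i k x
      using reg_order_2[of "Sig i" "Sig k"] gens[of i] gens[of k] that
      by (auto simp: C_matrix_def doubleton_eq_iff)
    show "reg (Sig i) (reg (T n) x) = reg (T n) (reg (Sig i) x)" if "i + 1 < n" for i x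
      using reg_order_2[of "Sig i" "T n"] gens[of i] t that
      by (auto simp: C_matrix_def doubleton_eq_iff)
    show "reg (Sig i) (reg (Sig (i + 1)) (reg (Sig i) x)) =
        reg (Sig (i + 1)) (reg (Sig i) (reg (Sig (i + 1)) x))" if "1 \<le> i" "i + 1 < n" for i x
      using that by (intro reg_order_3 gens) (auto simp: C_matrix_def doubleton_eq_iff)
    show "reg (Sig 0) (reg (Sig 1) (reg (Sig 0) (reg (Sig 1) x))) =
        reg (Sig 1) (reg (Sig 0) (reg (Sig 1) (reg (Sig 0) x)))" for x
      using n by (intro reg_order_4 gens) (auto simp: C_matrix_def doubleton_eq_iff)
    show "reg (Sig (n - 1)) (reg (T n) (reg (Sig (n - 1)) (reg (T n) x))) =
        reg (T n) (reg (Sig (n - 1)) (reg (T n) (reg (Sig (n - 1)) x)))" for x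
      using n by (intro reg_order_4 gens t) (auto simp: C_matrix_def doubleton_eq_iff)
  qed (use n gens t in auto)
qed

text \<open>The diagram automorphism of type affine B exchanging \<open>\<sigma>\<^sub>1\<close> and \<open>\<sigma>\<close> with index 1-bar.\<close>

definition swap_bar :: "gen \<Rightarrow> gen" where
  "swap_bar s = (if s = Sig 1 then SigBar else if s = SigBar then Sig 1 else s)"

lemma B_matrix_swap_bar:
  assumes "3 \<le> n"
  shows "B_matrix n (swap_bar s) (swap_bar t) = B_matrix n s t"
proof -
  have row: "B_matrix n u v = (if v = Sig 2 then 3 else 2)" "B_matrix n v u = (if v = Sig 2 then 3 else 2)"
    if "u = Sig 1 \<or> u = SigBar" "v \<noteq> Sig 1" "v \<noteq> SigBar" for u v
    using that assms by (auto simp: B_matrix_def doubleton_eq_iff numeral_2_eq_2)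
  have bar: "B_matrix n (Sig 1) SigBar = 2" "B_matrix n SigBar (Sig 1) = 2"
    by (simp_all add: B_matrix_def doubleton_eq_iff)
  have diag: "B_matrix n u u = 1" for u
    by (simp add: B_matrix_def)
  consider "s = Sig 1" | "s = SigBar" | "s \<noteq> Sig 1" "s \<noteq> SigBar" by blast
  then show ?thesis
  proof cases
    case 1
    then show ?thesis
      by (cases "t = Sig 1"; cases "t = SigBar") (simp_all add: swap_bar_def bar diag row del: One_nat_def)
  next
    case 2
    then show ?thesis
      by (cases "t = Sig 1"; cases "t = SigBar") (simp_all add: swap_bar_def bar diag row del: One_nat_def)
  next
    case 3
    then show ?thesis
      by (cases "t = Sig 1"; cases "t = SigBar") (simp_all add: swap_bar_def row del: One_nat_def)
  qed
qed

text \<open>The group of type affine C is the semidirect product of the group of type affine B with the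
  group of order 2 generated by \<open>\<sigma>\<^sub>0\<close>, which acts by the diagram automorphism.  Accordingly, the regular
  action of type affine B induces an action of type affine C on two copies: on the second copy the
  generators of type affine B act through the automorphism, and \<open>\<sigma>\<^sub>0\<close> exchanges the copies.\<close>

definition twisted :: "nat \<Rightarrow> gen \<Rightarrow> bool \<times> gen list set \<Rightarrow> bool \<times> gen list set" where
  "twisted n s = (\<lambda>(b, x).
    (b, coxeter_words.reg (B_gens n) (B_matrix n) (if b then swap_bar s else s) x))"

definition twisted_Sig :: "nat \<Rightarrow> nat \<Rightarrow> bool \<times> gen list set \<Rightarrow> bool \<times> gen list set" where
  "twisted_Sig n i = (if i = 0 then (\<lambda>(b, x). (\<not> b, x)) else twisted n (Sig i))"

lemma affine_C_action_twisted:
  assumes n: "3 \<le> n"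
  shows "affine_C_action n (twisted_Sig n) (twisted n (T n))"
proof -
  interpret coxeter_words "B_gens n" "B_matrix n" by (rule coxeter_words_B)
  have gens: "Sig i \<in> B_gens n" if "1 \<le> i" "i < n" for i
    using that by (auto simp: B_gens_def)
  have bt: "T n \<in> B_gens n" "SigBar \<in> B_gens n" by (simp_all add: B_gens_def)
  have swap: "(if b then swap_bar s else s) \<in> B_gens n" if "s \<in> B_gens n" for b s
    using that bt gens[of 1] n by (auto simp: swap_bar_def)
  have mat: "B_matrix n (if b then swap_bar s else s) (if b then swap_bar t else t) = B_matrix n s t"
    for b s t
    using B_matrix_swap_bar[OF n] by simp
  have [simp]: "twisted n s (b, x) = (b, reg (if b then swap_bar s else s) x)" for s b x
    by (simp add: twisted_def)
  have [simp]: "twisted_Sig n 0 (b, x) = (\<not> b, x)" for b x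
    by (simp add: twisted_Sig_def)
  have Sig: "twisted_Sig n i = twisted n (Sig i)" if "1 \<le> i" for i
    using that by (simp add: twisted_Sig_def)
  have o1: "twisted n s (twisted n s y) = y" if "s \<in> B_gens n" for s y
    using swap[OF that] by (cases y) simp
  have o2: "twisted n s (twisted n t y) = twisted n t (twisted n s y)"
    if "s \<in> B_gens n" "t \<in> B_gens n" "B_matrix n s t = 2" for s t y
    using reg_order_2[OF swap[OF that(1)] swap[OF that(2)]] mat that(3)
    by (cases y) (simp del: if_split)
  have o3: "twisted n s (twisted n t (twisted n s y)) = twisted n t (twisted n s (twisted n t y))"
    if "s \<in> B_gens n" "t \<in> B_gens n" "B_matrix n s t = 3" for s t y
    using reg_order_3[OF swap[OF that(1)] swap[OF that(2)]] mat that(3)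
    by (cases y) (simp del: if_split)
  have o4: "twisted n s (twisted n t (twisted n s (twisted n t y))) =
      twisted n t (twisted n s (twisted n t (twisted n s y)))"
    if "s \<in> B_gens n" "t \<in> B_gens n" "B_matrix n s t = 4" for s t y
    using reg_order_4[OF swap[OF that(1)] swap[OF that(2)]] mat that(3)
    by (cases y) (simp del: if_split)
  show ?thesis
  proof
    show "2 \<le> n" using n by simp
  next
    fix i y assume "i < n"
    then show "twisted_Sig n i (twisted_Sig n i y) = y"
      using Sig[of i] o1[OF gens[of i], of y] by (cases "i = 0"; cases y) (simp_all del: if_split)
  next
    fix y show "twisted n (T n) (twisted n (T n) y) = y"
      using o1 bt by blast
  next
    fix y :: "bool \<times> gen list set"
    obtain b x where y: "y = (b, x)" by fastforce
    have "B_matrix n (Sig 1) SigBar = 2"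
      by (simp add: B_matrix_def doubleton_eq_iff)
    from reg_order_2[OF gens[of 1] bt(2) this]
    show "twisted_Sig n 0 (twisted_Sig n 1 (twisted_Sig n 0 (twisted_Sig n 1 y))) =
        twisted_Sig n 1 (twisted_Sig n 0 (twisted_Sig n 1 (twisted_Sig n 0 y)))"
      using n Sig[of 1] by (simp add: y swap_bar_def)
  next
    fix i y assume i: "1 \<le> i" "i + 1 < n"
    then have "B_matrix n (Sig i) (Sig (i + 1)) = 3"
      by (auto simp: B_matrix_def doubleton_eq_iff)
    from o3[OF gens gens this] i
    show "twisted_Sig n i (twisted_Sig n (i + 1) (twisted_Sig n i y)) =
        twisted_Sig n (i + 1) (twisted_Sig n i (twisted_Sig n (i + 1) y))"
      by (simp add: Sig)
  next
    fix y
    have "B_matrix n (Sig (n - 1)) (T n) = 4"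
      by (auto simp: B_matrix_def doubleton_eq_iff)
    from o4[OF gens bt(1) this] n
    show "twisted_Sig n (n - 1) (twisted n (T n) (twisted_Sig n (n - 1) (twisted n (T n) y))) =
        twisted n (T n) (twisted_Sig n (n - 1) (twisted n (T n) (twisted_Sig n (n - 1) y)))"
      by (simp add: Sig)
  next
    fix i k y assume ik: "i + 1 < k" "k < n"
    show "twisted_Sig n i (twisted_Sig n k y) = twisted_Sig n k (twisted_Sig n i y)"
    proof (cases "i = 0")
      case True
      then show ?thesis using ik Sig[of k] by (cases y) (simp add: swap_bar_def)
    next
      case False
      then have "B_matrix n (Sig i) (Sig k) = 2"
        using ik by (auto simp: B_matrix_def doubleton_eq_iff)
      from o2[OF gens gens this] False ik show ?thesis by (simp add: Sig)
    qed
  next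
    fix i y assume i: "i + 1 < n"
    show "twisted_Sig n i (twisted n (T n) y) = twisted n (T n) (twisted_Sig n i y)"
    proof (cases "i = 0")
      case True
      then show ?thesis by (cases y) (simp add: swap_bar_def)
    next
      case False
      then have "B_matrix n (Sig i) (T n) = 2"
        using i by (auto simp: B_matrix_def doubleton_eq_iff)
      from o2[OF gens bt(1) this] False i show ?thesis by (simp add: Sig)
    qed
  qed
qed


section \<open>Injectivity of the substitution on group elements\<close>

text \<open>On strand \<open>n + 1\<close>, the image of a word acts as the word itself.\<close>

lemma strand_act_\<phi>:
  assumes "coxeter_tower S m S' m' (T n) (Sig n) (T (n + 1))" "2 \<le> n"
    and u: "u \<in> lists S" and S: "S \<subseteq> insert SigBar (C_gens n)"
  shows "foldr (gen_act (strand n p) (strand_t n pt)) (coxeter_tower.\<phi> (T n) (Sig n) (T (n + 1)) u) (n + 1, x)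
    = (n + 1, foldr (gen_act p pt) u x)"
proof -
  interpret coxeter_tower S m S' m' "T n" "Sig n" "T (n + 1)" by fact
  have step: "foldr (gen_act (strand n p) (strand_t n pt)) (expand s) (n + 1, x) = (n + 1, gen_act p pt s x)"
    if "s \<in> S" for s x
  proof -
    from that S consider "s = SigBar" | "s = T n" | i where "s = Sig i" "i < n"
      using \<open>2 \<le> n\<close> by (fastforce simp: C_gens_def)
    then show ?thesis
      using \<open>2 \<le> n\<close> by cases (simp_all add: expand_def[simplified] strand_def strand_t_def)
  qed
  show ?thesis
    using u
  proof (induction u rule: list.induct)
    case (Cons s u)
    then have "foldr (gen_act (strand n p) (strand_t n pt)) (\<phi> u) (n + 1, x)
        = (n + 1, foldr (gen_act p pt) u x)" "s \<in> S" by simp_all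
    then show ?case
      by (simp only: \<phi>_simps foldr_append foldr.simps comp_apply step)
  qed (simp only: \<phi>_simps foldr.simps id_apply)
qed

lemma faithful_coxeter_tower_C:
  assumes n: "2 \<le> n"
  shows "faithful_coxeter_tower (C_gens n) (C_matrix n) (C_gens (n + 1)) (C_matrix (n + 1))
    (T n) (Sig n) (T (n + 1))"
proof -
  interpret tower: coxeter_tower "C_gens n" "C_matrix n" "C_gens (n + 1)" "C_matrix (n + 1)"
    "T n" "Sig n" "T (n + 1)"
  proof (intro coxeter_tower.intro coxeter_words_C coxeter_tower_axioms.intro)
    fix s assume "s \<in> C_gens n - {T n}"
    then obtain i where i: "s = Sig i" "i < n"
      using n by (fastforce simp: C_gens_def)
    then show "s \<in> C_gens (n + 1)" by (simp add: C_gens_def)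
    show "C_matrix (n + 1) (T (n + 1)) s = 2"
      using i by (auto simp: C_matrix_def doubleton_eq_iff)
  qed (auto simp: C_gens_def C_matrix_def doubleton_eq_iff)
  let ?p = "\<lambda>i. tower.A.reg (Sig i)" and ?pt = "tower.A.reg (T n)"
  interpret act': affine_C_action "n + 1" "strand n ?p" "strand_t n ?pt"
    using affine_C_action.affine_C_action_strand affine_C_action_reg n by blast
  have act: "foldr act'.act u = foldr act'.act v"
    if "cox_eq (C_gens (n + 1)) (C_matrix (n + 1)) u v" for u v
    using act'.act_relator_C by (rule tower.B.foldr_respects_E[OF _ that])
  have strand: "foldr act'.act (tower.\<phi> u) (n + 1, x) = (n + 1, tower.A.\<rho> u x)"
    if u: "u \<in> lists (C_gens n)" for u x
  proof -
    have "foldr (gen_act ?p ?pt) u x = tower.A.\<rho> u x"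
      using u by (induction u rule: list.induct) (auto simp: C_gens_def)
    then show ?thesis
      using strand_act_\<phi>[OF tower.coxeter_tower_axioms n u, of ?p ?pt x] by auto
  qed
  show ?thesis
  proof
    fix u v assume uv: "u \<in> lists (C_gens n)" "v \<in> lists (C_gens n)"
      "cox_eq (C_gens (n + 1)) (C_matrix (n + 1)) (tower.\<phi> u) (tower.\<phi> v)"
    have "tower.A.\<rho> u = tower.A.\<rho> v"
    proof
      fix x show "tower.A.\<rho> u x = tower.A.\<rho> v x"
        using strand[OF uv(1), of x] strand[OF uv(2), of x] act[OF uv(3)] by simp
    qed
    then show "cox_eq (C_gens n) (C_matrix n) u v"
      using tower.A.\<rho>_eq_iff uv by blast
  next
    show "\<not> cox_eq (C_gens (n + 1)) (C_matrix (n + 1)) [Sig n, T (n + 1)] [T (n + 1), Sig n]"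
    proof
      assume "cox_eq (C_gens (n + 1)) (C_matrix (n + 1)) [Sig n, T (n + 1)] [T (n + 1), Sig n]"
      \<comment> \<open>Strand \<open>n + 1\<close> detects \<open>t\<^sub>n\<close> on one side only, and \<open>t\<^sub>n\<close> is not trivial by parity of length.\<close>
      from fun_cong[OF act[OF this], of "(n + 1, x)" for x] have "?pt x = x" for x
        using n by (simp add: strand_def strand_t_def)
      then have "tower.A.\<rho> [T n] = tower.A.\<rho> []" by (simp add: fun_eq_iff)
      then have "cox_eq (C_gens n) (C_matrix n) [T n] []"
        using tower.A.\<rho>_eq_iff[of "[T n]" "[]"] by (simp add: C_gens_def)
      from tower.A.E_even_length[OF this] show False by simp
    qed
  qed
qed

lemma faithful_coxeter_tower_B:
  assumes n: "3 \<le> n"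
  shows "faithful_coxeter_tower (B_gens n) (B_matrix n) (B_gens (n + 1)) (B_matrix (n + 1))
    (T n) (Sig n) (T (n + 1))"
proof -
  interpret tower: coxeter_tower "B_gens n" "B_matrix n" "B_gens (n + 1)" "B_matrix (n + 1)"
    "T n" "Sig n" "T (n + 1)"
  proof (intro coxeter_tower.intro coxeter_words_B coxeter_tower_axioms.intro)
    fix s assume "s \<in> B_gens n - {T n}"
    then consider "s = SigBar" | i where "s = Sig i" "1 \<le> i" "i < n"
      using n by (fastforce simp: B_gens_def)
    then show "s \<in> B_gens (n + 1)" "B_matrix (n + 1) (T (n + 1)) s = 2"
      by (cases; auto simp: B_gens_def B_matrix_def doubleton_eq_iff)+
  qed (use n in \<open>auto simp: B_gens_def B_matrix_def doubleton_eq_iff\<close>)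
  let ?p = "twisted_Sig n" and ?pt = "twisted n (T n)"
  interpret act': affine_C_action "n + 1" "strand n ?p" "strand_t n ?pt"
    using affine_C_action.affine_C_action_strand affine_C_action_twisted n by blast
  have act: "foldr act'.act u = foldr act'.act v"
    if "cox_eq (B_gens (n + 1)) (B_matrix (n + 1)) u v" for u v
    using act'.act_relator_B n by (intro tower.B.foldr_respects_E[OF _ that]) simp
  \<comment> \<open>The copy labelled \<open>False\<close> carries the regular action itself.\<close>
  have strand: "foldr act'.act (tower.\<phi> u) (n + 1, False, x) = (n + 1, False, tower.A.\<rho> u x)"
    if u: "u \<in> lists (B_gens n)" for u x
  proof -
    have "gen_act ?p ?pt s (False, x) = (False, tower.A.reg s x)" if s: "s \<in> B_gens n" for s x
    proof -
      from s consider "s = SigBar" | "s = T n" | i where "s = Sig i" "1 \<le> i"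
        by (fastforce simp: B_gens_def)
      then show ?thesis
        by cases (simp_all add: twisted_Sig_def twisted_def swap_bar_def)
    qed
    then have "foldr (gen_act ?p ?pt) u (False, x) = (False, tower.A.\<rho> u x)"
      using u by (induction u rule: list.induct) auto
    moreover have "B_gens n \<subseteq> insert SigBar (C_gens n)"
      by (auto simp: B_gens_def C_gens_def)
    ultimately show ?thesis
      using strand_act_\<phi>[OF tower.coxeter_tower_axioms _ u, of ?p ?pt "(False, x)"] n by simp
  qed
  show ?thesis
  proof
    fix u v assume uv: "u \<in> lists (B_gens n)" "v \<in> lists (B_gens n)"
      "cox_eq (B_gens (n + 1)) (B_matrix (n + 1)) (tower.\<phi> u) (tower.\<phi> v)"
    have "tower.A.\<rho> u = tower.A.\<rho> v"
    proof
      fix x show "tower.A.\<rho> u x = tower.A.\<rho> v x"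
        using strand[OF uv(1), of x] strand[OF uv(2), of x] act[OF uv(3)] by simp
    qed
    then show "cox_eq (B_gens n) (B_matrix n) u v"
      using tower.A.\<rho>_eq_iff uv by blast
  next
    show "\<not> cox_eq (B_gens (n + 1)) (B_matrix (n + 1)) [Sig n, T (n + 1)] [T (n + 1), Sig n]"
    proof
      assume "cox_eq (B_gens (n + 1)) (B_matrix (n + 1)) [Sig n, T (n + 1)] [T (n + 1), Sig n]"
      \<comment> \<open>Strand \<open>n + 1\<close> detects \<open>t\<^sub>n\<close> on one side only, and \<open>t\<^sub>n\<close> is not trivial by parity of length.\<close>
      from fun_cong[OF act[OF this], of "(n + 1, False, x)" for x] have "tower.A.reg (T n) x = x" for x
        using n by (simp add: strand_def strand_t_def twisted_def swap_bar_def)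
      then have "tower.A.\<rho> [T n] = tower.A.\<rho> []" by (simp add: fun_eq_iff)
      then have "cox_eq (B_gens n) (B_matrix n) [T n] []"
        using tower.A.\<rho>_eq_iff[of "[T n]" "[]"] by (simp add: B_gens_def)
      from tower.A.E_even_length[OF this] show False by simp
    qed
  qed
qed


section \<open>Length and reduced words\<close>

context coxeter_words
begin

lemma ex_reduced:
  assumes "w \<in> carrier W"
  obtains u where "reduced u" "w = cl u"
proof -
  obtain u0 where u0: "u0 \<in> lists S" "w = cl u0" using assms carrier_W by auto
  define u where "u = arg_min length (E u0)"
  have "E u0 u0" using u0 by (intro cox_refl)
  then have u: "E u0 u" "\<And>v. E u0 v \<Longrightarrow> length u \<le> length v"
    unfolding u_def by (auto intro: arg_min_natI[of "E u0"] arg_min_nat_le[of "E u0"])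
  have "reduced u"
    unfolding reduced_def
  proof (intro conjI allI impI)
    show "u \<in> lists S" using E_lists[OF u(1)] by blast
    fix v assume "E u v"
    from u(2)[OF cox_trans[OF u(1) this]] show "length u \<le> length v" .
  qed
  moreover have "w = cl u" using u(1) cl_eq_iff[OF u0(1)] u0(2) by simp
  ultimately show ?thesis using that by blast
qed

lemma cox_length_reduced:
  assumes "reduced u"
  shows "cox_length (cl u) = length u"
  unfolding cox_length_def
proof (rule Least_equality)
  show "\<exists>v\<in>cl u. length v = length u"
    using assms by (auto simp: cox_class_def reduced_def intro!: bexI[of _ u] cox_refl)
qed (use assms in \<open>auto simp: cox_class_def reduced_def\<close>)

lemma cox_length_le: "u \<in> lists S \<Longrightarrow> cox_length (cl u) \<le> length u"
  unfolding cox_length_def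
  by (rule Least_le) (auto simp: cox_class_def intro!: bexI[of _ u] cox_refl)

lemma even_cox_length:
  assumes "u \<in> lists S"
  shows "even (cox_length (cl u)) = even (length u)"
proof -
  have "cl u \<in> carrier W" using assms carrier_W by blast
  then obtain v where "reduced v" "cl u = cl v" by (rule ex_reduced)
  then show ?thesis
    using E_even_length[of u v] cl_eq_iff[OF assms, of v] cox_length_reduced[of v] by simp
qed

lemma reduced_Nil: "reduced []"
  by (auto simp: reduced_def)

lemma reduced_single:
  assumes "s \<in> S"
  shows "reduced [s]"
  unfolding reduced_def
proof (intro conjI allI impI)
  fix v assume "E [s] v"
  from E_even_length[OF this] show "length [s] \<le> length v"
    by (cases v) auto
qed (use assms in simp)

lemma gen_mult_carrier:
  assumes "s \<in> S" "w \<in> carrier W"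
  shows "cl [s] \<otimes>\<^bsub>W\<^esub> w \<in> carrier W"
proof -
  obtain u where "u \<in> lists S" "w = cl u" using assms carrier_W by auto
  then show ?thesis
    using mult_cl[of "[s]" u] assms by (simp add: carrier_W del: in_lists_conv_set)
qed

lemma gen_mult_length:
  assumes "s \<in> S" "w \<in> carrier W"
  shows "cox_length (cl [s] \<otimes>\<^bsub>W\<^esub> w) \<noteq> cox_length w"
    and "cox_length (cl [s] \<otimes>\<^bsub>W\<^esub> w) \<le> cox_length w + 1"
proof -
  obtain u where u: "reduced u" "w = cl u" using ex_reduced[OF assms(2)] .
  then have ul: "u \<in> lists S" by (simp add: reduced_def)
  have eq: "cl [s] \<otimes>\<^bsub>W\<^esub> w = cl (s # u)"
    using mult_cl[of "[s]" u] u ul assms by simp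
  have su: "s # u \<in> lists S" using ul assms(1) by simp
  have "even (cox_length (cl (s # u))) \<noteq> even (cox_length (cl u))"
    unfolding even_cox_length[OF su] even_cox_length[OF ul] by simp
  then show "cox_length (cl [s] \<otimes>\<^bsub>W\<^esub> w) \<noteq> cox_length w"
    using eq u(2) by metis
  show "cox_length (cl [s] \<otimes>\<^bsub>W\<^esub> w) \<le> cox_length w + 1"
  proof -
    have "cox_length (cl [s] \<otimes>\<^bsub>W\<^esub> w) \<le> length (s # u)"
      using cox_length_le[OF su] by (simp only: eq)
    moreover have "cox_length w = length u"
      by (simp only: u(2) cox_length_reduced[OF u(1)])
    ultimately show ?thesis by simp
  qed
qed

end


section \<open>Spans of standard basis elements\<close>

text \<open>A Hecke algebra of a system whose matrix has diagonal entries \<open>1\<close>, so that generators are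
  involutions.\<close>

locale hecke_words = hecke_algebra K H q S m g + coxeter_words S m
  for K :: "('k, 'p) ring_scheme" (structure) and H :: "('k, 'a, 'r) module_scheme" (structure)
    and q :: 'k and S :: "'s set" and m :: "'s \<Rightarrow> 's \<Rightarrow> nat" and g :: "'s list set \<Rightarrow> 'a"
begin

text \<open>The \<open>K\<close>-span of the standard basis elements indexed by \<open>A\<close>, built up term by term; the same index
  may be used repeatedly.\<close>

inductive_set std_span :: "'s list set set \<Rightarrow> 'a set" for A :: "'s list set set" where
  zero: "\<zero>\<^bsub>H\<^esub> \<in> std_span A"
| add: "\<lbrakk>c \<in> carrier K; w \<in> A; y \<in> std_span A\<rbrakk> \<Longrightarrow> c \<odot>\<^bsub>H\<^esub> g w \<oplus>\<^bsub>H\<^esub> y \<in> std_span A"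

lemma g_closed [simp]: "w \<in> carrier W \<Longrightarrow> g w \<in> carrier H"
  using basis by (auto simp: is_basis_def)

lemma std_span_closed:
  assumes "x \<in> std_span A" "A \<subseteq> carrier W"
  shows "x \<in> carrier H"
  using assms by (induction rule: std_span.induct) auto

lemma std_span_mono: "\<lbrakk>x \<in> std_span A; A \<subseteq> B\<rbrakk> \<Longrightarrow> x \<in> std_span B"
  by (induction rule: std_span.induct) (auto intro: std_span.intros)

lemma std_span_add:
  assumes "x \<in> std_span A" "y \<in> std_span A" "A \<subseteq> carrier W"
  shows "x \<oplus>\<^bsub>H\<^esub> y \<in> std_span A"
  using assms(1)
proof (induction rule: std_span.induct)
  case zero
  then show ?case using assms std_span_closed by simp
next
  case (add c w z)
  have "(c \<odot>\<^bsub>H\<^esub> g w \<oplus>\<^bsub>H\<^esub> z) \<oplus>\<^bsub>H\<^esub> y = c \<odot>\<^bsub>H\<^esub> g w \<oplus>\<^bsub>H\<^esub> (z \<oplus>\<^bsub>H\<^esub> y)"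
    using add assms std_span_closed by (intro M.a_assoc) auto
  then show ?case using add std_span.add by simp
qed

lemma std_span_smult:
  assumes "x \<in> std_span A" "a \<in> carrier K" "A \<subseteq> carrier W"
  shows "a \<odot>\<^bsub>H\<^esub> x \<in> std_span A"
  using assms(1)
proof (induction rule: std_span.induct)
  case zero
  then show ?case using assms std_span.zero by simp
next
  case (add c w z)
  have "a \<odot>\<^bsub>H\<^esub> (c \<odot>\<^bsub>H\<^esub> g w \<oplus>\<^bsub>H\<^esub> z) = (a \<otimes> c) \<odot>\<^bsub>H\<^esub> g w \<oplus>\<^bsub>H\<^esub> a \<odot>\<^bsub>H\<^esub> z"
    using add assms std_span_closed by (subst smult_r_distr) (auto simp: smult_assoc1)
  then show ?case using add assms std_span.add by simp
qed

lemma std_span_base: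
  assumes "w \<in> A" "A \<subseteq> carrier W"
  shows "g w \<in> std_span A"
  using std_span.add[OF R.one_closed assms(1) std_span.zero] assms by (auto simp: subset_iff)

lemma std_span_finsum:
  assumes "x \<in> std_span A" "A \<subseteq> carrier W"
  shows "\<exists>J c. finite J \<and> J \<subseteq> A \<and> c \<in> J \<rightarrow> carrier K \<and> x = (\<Oplus>\<^bsub>H\<^esub>i\<in>J. c i \<odot>\<^bsub>H\<^esub> g i)"
  using assms(1)
proof (induction rule: std_span.induct)
  case zero
  then show ?case by (intro exI[of _ "{}"]) auto
next
  case (add a w y)
  then obtain J c where J: "finite J" "J \<subseteq> A" "c \<in> J \<rightarrow> carrier K" "y = (\<Oplus>\<^bsub>H\<^esub>i\<in>J. c i \<odot>\<^bsub>H\<^esub> g i)"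
    by blast
  have cl: "\<And>i. i \<in> J \<Longrightarrow> c i \<in> carrier K \<and> g i \<in> carrier H" "g w \<in> carrier H"
    using J assms add by auto
  show ?case
  proof (cases "w \<in> J")
    case False
    have "(\<Oplus>\<^bsub>H\<^esub>i\<in>insert w J. (c(w := a)) i \<odot>\<^bsub>H\<^esub> g i) =
        a \<odot>\<^bsub>H\<^esub> g w \<oplus>\<^bsub>H\<^esub> (\<Oplus>\<^bsub>H\<^esub>i\<in>J. (c(w := a)) i \<odot>\<^bsub>H\<^esub> g i)"
      using J False cl add(1) by (subst M.finsum_insert) auto
    also have "(\<Oplus>\<^bsub>H\<^esub>i\<in>J. (c(w := a)) i \<odot>\<^bsub>H\<^esub> g i) = y"
      unfolding J(4) using False cl by (intro M.finsum_cong') auto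
    finally show ?thesis
      using J add by (intro exI[of _ "insert w J"] exI[of _ "c(w := a)"]) auto
  next
    case True
    let ?J = "J - {w}"
    have ins: "J = insert w ?J" using True by blast
    have y: "y = c w \<odot>\<^bsub>H\<^esub> g w \<oplus>\<^bsub>H\<^esub> (\<Oplus>\<^bsub>H\<^esub>i\<in>?J. c i \<odot>\<^bsub>H\<^esub> g i)"
      unfolding J(4) using J True cl by (subst ins, subst M.finsum_insert) auto
    have "(\<Oplus>\<^bsub>H\<^esub>i\<in>J. (c(w := a \<oplus> c w)) i \<odot>\<^bsub>H\<^esub> g i) =
        (a \<oplus> c w) \<odot>\<^bsub>H\<^esub> g w \<oplus>\<^bsub>H\<^esub> (\<Oplus>\<^bsub>H\<^esub>i\<in>?J. (c(w := a \<oplus> c w)) i \<odot>\<^bsub>H\<^esub> g i)"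
      using J True cl add(1) by (subst ins, subst M.finsum_insert) auto
    also have "(\<Oplus>\<^bsub>H\<^esub>i\<in>?J. (c(w := a \<oplus> c w)) i \<odot>\<^bsub>H\<^esub> g i) = (\<Oplus>\<^bsub>H\<^esub>i\<in>?J. c i \<odot>\<^bsub>H\<^esub> g i)"
      using cl by (intro M.finsum_cong') auto
    also have "(a \<oplus> c w) \<odot>\<^bsub>H\<^esub> g w = a \<odot>\<^bsub>H\<^esub> g w \<oplus>\<^bsub>H\<^esub> c w \<odot>\<^bsub>H\<^esub> g w"
      using cl True add(1) by (simp add: smult_l_distr)
    also have "\<dots> \<oplus>\<^bsub>H\<^esub> (\<Oplus>\<^bsub>H\<^esub>i\<in>?J. c i \<odot>\<^bsub>H\<^esub> g i) = a \<odot>\<^bsub>H\<^esub> g w \<oplus>\<^bsub>H\<^esub> y"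
      unfolding y using cl True add(1) by (intro M.a_assoc M.finsum_closed) auto
    finally have "a \<odot>\<^bsub>H\<^esub> g w \<oplus>\<^bsub>H\<^esub> y = (\<Oplus>\<^bsub>H\<^esub>i\<in>J. (c(w := a \<oplus> c w)) i \<odot>\<^bsub>H\<^esub> g i)" ..
    moreover have "c(w := a \<oplus> c w) \<in> J \<rightarrow> carrier K"
      using cl True add(1) by simp
    ultimately show ?thesis using J(1,2) by blast
  qed
qed

lemma leading_coefficient_zero:
  assumes "x \<in> std_span A" "A \<subseteq> carrier W" "v \<in> carrier W" "v \<notin> A" "a \<in> carrier K"
    and zero: "a \<odot>\<^bsub>H\<^esub> g v \<oplus>\<^bsub>H\<^esub> x = \<zero>\<^bsub>H\<^esub>"
  shows "a = \<zero>"
proof -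
  obtain J c where J: "finite J" "J \<subseteq> A" "c \<in> J \<rightarrow> carrier K" "x = (\<Oplus>\<^bsub>H\<^esub>i\<in>J. c i \<odot>\<^bsub>H\<^esub> g i)"
    using std_span_finsum[OF assms(1,2)] by blast
  have cl: "\<And>i. i \<in> J \<Longrightarrow> c i \<in> carrier K \<and> g i \<in> carrier H" and v: "v \<notin> J"
    using J assms by auto
  let ?c = "c(v := a)"
  have "(\<Oplus>\<^bsub>H\<^esub>i\<in>insert v J. ?c i \<odot>\<^bsub>H\<^esub> g i) =
      a \<odot>\<^bsub>H\<^esub> g v \<oplus>\<^bsub>H\<^esub> (\<Oplus>\<^bsub>H\<^esub>i\<in>J. ?c i \<odot>\<^bsub>H\<^esub> g i)"
    using J v cl assms by (subst M.finsum_insert) auto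
  also have "(\<Oplus>\<^bsub>H\<^esub>i\<in>J. ?c i \<odot>\<^bsub>H\<^esub> g i) = x"
    unfolding J(4) using v cl by (intro M.finsum_cong') auto
  finally have "(\<Oplus>\<^bsub>H\<^esub>i\<in>insert v J. ?c i \<odot>\<^bsub>H\<^esub> g i) = \<zero>\<^bsub>H\<^esub>"
    using zero by simp
  moreover have "finite (insert v J)" "insert v J \<subseteq> carrier W" "?c \<in> insert v J \<rightarrow> carrier K"
    using J assms by auto
  ultimately have "\<forall>i\<in>insert v J. ?c i = \<zero>"
    using basis unfolding is_basis_def by blast
  then show ?thesis by simp
qed


section \<open>Products of generators\<close>

text \<open>The span of the basis elements of length less than \<open>k\<close>: the part of a filtration that
  multiplication by a generator raises by one.\<close>

definition below :: "nat \<Rightarrow> 'a set" where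
  "below k = std_span {w \<in> carrier W. cox_length w < k}"

lemma below_closed: "x \<in> below k \<Longrightarrow> x \<in> carrier H"
  unfolding below_def by (rule std_span_closed) auto

lemma below_mono: "\<lbrakk>x \<in> below j; j \<le> k\<rbrakk> \<Longrightarrow> x \<in> below k"
  unfolding below_def by (erule std_span_mono) auto

lemma below_zero: "\<zero>\<^bsub>H\<^esub> \<in> below k"
  unfolding below_def by (rule std_span.zero)

lemma below_add: "\<lbrakk>x \<in> below k; y \<in> below k\<rbrakk> \<Longrightarrow> x \<oplus>\<^bsub>H\<^esub> y \<in> below k"
  unfolding below_def by (rule std_span_add) auto

lemma below_smult: "\<lbrakk>x \<in> below k; a \<in> carrier K\<rbrakk> \<Longrightarrow> a \<odot>\<^bsub>H\<^esub> x \<in> below k"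
  unfolding below_def by (rule std_span_smult) auto

lemma below_base: "\<lbrakk>w \<in> carrier W; cox_length w < k\<rbrakk> \<Longrightarrow> g w \<in> below k"
  unfolding below_def by (rule std_span_base) auto

abbreviation gen :: "'s \<Rightarrow> 'a" where "gen s \<equiv> g (cl [s])"

lemma gen_closed [simp]: "s \<in> S \<Longrightarrow> gen s \<in> carrier H"
  by (simp add: carrier_W)

lemma gen_mult_below:
  assumes "s \<in> S" "x \<in> below k"
  shows "gen s \<otimes>\<^bsub>H\<^esub> x \<in> below (Suc k)"
  using assms(2) unfolding below_def[of k]
proof (induction rule: std_span.induct)
  case zero
  then show ?case using assms by (simp add: below_zero)
next
  case (add c w y)
  then have w: "w \<in> carrier W" "cox_length w < k" by auto
  have y: "y \<in> carrier H" using add below_closed[of y k] by (simp add: below_def)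
  let ?sw = "cl [s] \<otimes>\<^bsub>W\<^esub> w"
  have "gen s \<otimes>\<^bsub>H\<^esub> g w \<in> below (Suc k)"
  proof (cases "cox_length ?sw < cox_length w")
    case True
    have "g ?sw \<in> below (Suc k)" "g w \<in> below (Suc k)"
      using w True gen_mult_carrier[OF assms(1) w(1)] by (auto intro!: below_base)
    then show ?thesis
      unfolding mult_down[OF assms(1) w(1) True]
      by (intro below_add below_smult q_closed R.minus_closed R.one_closed)
  next
    case False
    then have "cox_length w < cox_length ?sw" "cox_length ?sw < Suc k"
      using gen_mult_length[OF assms(1) w(1)] w(2) by linarith+
    then show ?thesis
      using mult_up[OF assms(1) w(1)] gen_mult_carrier[OF assms(1) w(1)] by (simp add: below_base)
  qed
  moreover have "gen s \<otimes>\<^bsub>H\<^esub> (c \<odot>\<^bsub>H\<^esub> g w \<oplus>\<^bsub>H\<^esub> y) =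
      c \<odot>\<^bsub>H\<^esub> (gen s \<otimes>\<^bsub>H\<^esub> g w) \<oplus>\<^bsub>H\<^esub> gen s \<otimes>\<^bsub>H\<^esub> y"
    using add w y assms(1) by (simp add: A.r_distr smult_mult_right)
  ultimately show ?case
    using add by (simp add: below_add below_smult)
qed

text \<open>The product of the generators of the Hecke algebra along a word, which need not be reduced.\<close>

definition gen_prod :: "'s list \<Rightarrow> 'a" where
  "gen_prod u = foldr (\<lambda>s x. gen s \<otimes>\<^bsub>H\<^esub> x) u \<one>\<^bsub>H\<^esub>"

lemma gen_prod_simps [simp]: "gen_prod [] = \<one>\<^bsub>H\<^esub>" "gen_prod (s # u) = gen s \<otimes>\<^bsub>H\<^esub> gen_prod u"
  by (simp_all add: gen_prod_def)

lemma gen_prod_closed [simp]: "u \<in> lists S \<Longrightarrow> gen_prod u \<in> carrier H"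
  by (induction u) auto

lemma gen_prod_reduced:
  assumes "reduced u"
  shows "gen_prod u = g (cl u)"
  using assms
proof (induction u)
  case Nil
  then show ?case using g_one one_W by simp
next
  case (Cons s u)
  then have u: "reduced u" "s \<in> S" "u \<in> lists S"
    using reduced_ConsD by (auto simp: reduced_def)
  have su: "cl [s] \<otimes>\<^bsub>W\<^esub> cl u = cl (s # u)"
    using mult_cl[of "[s]" u] u by simp
  have "gen s \<otimes>\<^bsub>H\<^esub> g (cl u) = g (cl [s] \<otimes>\<^bsub>W\<^esub> cl u)"
    using u Cons.prems by (intro mult_up) (auto simp: su cox_length_reduced carrier_W)
  then show ?case using Cons.IH u su by simp
qed

lemma gen_prod_below: "u \<in> lists S \<Longrightarrow> gen_prod u \<in> below (Suc (length u))"
proof (induction u)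
  case Nil
  have "g (cl []) \<in> below (Suc 0)"
    using cox_length_reduced[OF reduced_Nil] by (intro below_base) (auto simp: carrier_W)
  then show ?case using gen_prod_reduced[OF reduced_Nil] by simp
next
  case (Cons s u)
  then show ?case using gen_mult_below by simp
qed

lemma gen_inverse:
  assumes s: "s \<in> S" and q: "q \<in> Units K"
  shows "inv\<^bsub>H\<^esub> gen s = inv\<^bsub>K\<^esub> q \<odot>\<^bsub>H\<^esub> gen s \<oplus>\<^bsub>H\<^esub> (inv\<^bsub>K\<^esub> q \<ominus> \<one>) \<odot>\<^bsub>H\<^esub> \<one>\<^bsub>H\<^esub>"
proof -
  have gs: "gen s \<in> carrier H" using s by simp
  let ?i = "inv\<^bsub>K\<^esub> q"
  have i: "?i \<in> carrier K" "?i \<otimes> q = \<one>" using q by auto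
  have "E [s, s] []" using E_square[of s "[]" "[]"] s by simp
  then have ss: "cl [s] \<otimes>\<^bsub>W\<^esub> cl [s] = cl []"
    using mult_cl[of "[s]" "[s]"] cl_eq_iff[of "[s, s]" "[]"] s by simp
  have "gen s \<otimes>\<^bsub>H\<^esub> gen s =
      q \<odot>\<^bsub>H\<^esub> g (cl [s] \<otimes>\<^bsub>W\<^esub> cl [s]) \<oplus>\<^bsub>H\<^esub> (q \<ominus> \<one>) \<odot>\<^bsub>H\<^esub> gen s"
    using s cox_length_reduced[OF reduced_Nil] cox_length_reduced[OF reduced_single[OF s]]
    by (intro mult_down) (auto simp: ss carrier_W)
  then have sq: "gen s \<otimes>\<^bsub>H\<^esub> gen s = q \<odot>\<^bsub>H\<^esub> \<one>\<^bsub>H\<^esub> \<oplus>\<^bsub>H\<^esub> (q \<ominus> \<one>) \<odot>\<^bsub>H\<^esub> gen s"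
    using ss g_one one_W by simp
  let ?h = "?i \<odot>\<^bsub>H\<^esub> gen s \<oplus>\<^bsub>H\<^esub> (?i \<ominus> \<one>) \<odot>\<^bsub>H\<^esub> \<one>\<^bsub>H\<^esub>"
  have h: "?h \<in> carrier H" using gs i by simp
  have "?i \<otimes> (q \<ominus> \<one>) = \<one> \<ominus> ?i"
    using i q_closed by (simp add: R.r_distr R.r_minus a_minus_def)
  then have zero: "?i \<otimes> (q \<ominus> \<one>) \<oplus> (?i \<ominus> \<one>) = \<zero>"
    using i(1) by (simp only:) algebra
  have eq: "?i \<odot>\<^bsub>H\<^esub> (gen s \<otimes>\<^bsub>H\<^esub> gen s) \<oplus>\<^bsub>H\<^esub> (?i \<ominus> \<one>) \<odot>\<^bsub>H\<^esub> gen s = \<one>\<^bsub>H\<^esub>"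
  proof -
    have "?i \<odot>\<^bsub>H\<^esub> (gen s \<otimes>\<^bsub>H\<^esub> gen s) = \<one>\<^bsub>H\<^esub> \<oplus>\<^bsub>H\<^esub> (?i \<otimes> (q \<ominus> \<one>)) \<odot>\<^bsub>H\<^esub> gen s"
      unfolding sq using i gs q_closed
      by (simp add: smult_r_distr flip: smult_assoc1)
    then have "?i \<odot>\<^bsub>H\<^esub> (gen s \<otimes>\<^bsub>H\<^esub> gen s) \<oplus>\<^bsub>H\<^esub> (?i \<ominus> \<one>) \<odot>\<^bsub>H\<^esub> gen s =
        \<one>\<^bsub>H\<^esub> \<oplus>\<^bsub>H\<^esub> (?i \<otimes> (q \<ominus> \<one>) \<oplus> (?i \<ominus> \<one>)) \<odot>\<^bsub>H\<^esub> gen s"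
      using i(1) gs q_closed by (simp add: smult_l_distr M.a_assoc)
    also have "\<dots> = \<one>\<^bsub>H\<^esub>" unfolding zero using gs by simp
    finally show ?thesis .
  qed
  have "?h \<otimes>\<^bsub>H\<^esub> gen s = \<one>\<^bsub>H\<^esub>" "gen s \<otimes>\<^bsub>H\<^esub> ?h = \<one>\<^bsub>H\<^esub>"
    using eq gs i(1) by (simp_all add: A.l_distr A.r_distr smult_mult_left smult_mult_right)
  then show ?thesis
    using A.inv_unique'[OF gs h] by simp
qed

end


section \<open>Injectivity from leading terms\<close>

theorem (in faithful_coxeter_tower) hecke_hom_inj_on:
  fixes K :: "('k, 'p) ring_scheme" and H :: "('k, 'a, 'r) module_scheme"
    and H' :: "('k, 'b, 'z) module_scheme"
  assumes H: "hecke_algebra K H q S m e" and H': "hecke_algebra K H' q S' m' g"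
    and q: "q \<in> Units K"
    and hom: "R \<in> algebra_hom K H H'"
    and R_old: "\<And>s. s \<in> S - {t} \<Longrightarrow> R (e (A.cl [s])) = g (B.cl [s])"
    and R_t: "R (e (A.cl [t])) =
      g (B.cl [s']) \<otimes>\<^bsub>H'\<^esub> g (B.cl [\<tau>]) \<otimes>\<^bsub>H'\<^esub> inv\<^bsub>H'\<^esub> g (B.cl [s'])"
  shows "inj_on R (carrier H)"
proof -
  interpret X: hecke_words K H q S m e
    by (intro hecke_words.intro H A.coxeter_words_axioms)
  interpret Y: hecke_words K H' q S' m' g
    by (intro hecke_words.intro H' B.coxeter_words_axioms)
  have R_ring: "R \<in> ring_hom H H'"
    and R_smult: "\<And>a x. \<lbrakk>a \<in> carrier K; x \<in> carrier H\<rbrakk> \<Longrightarrow> R (a \<odot>\<^bsub>H\<^esub> x) = a \<odot>\<^bsub>H'\<^esub> R x"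
    using hom by (auto simp: algebra_hom_def)
  interpret R: ring_hom_ring H H' R
    using R_ring X.A.ring_axioms Y.A.ring_axioms by (intro ring_hom_ringI2)
  let ?i = "inv\<^bsub>K\<^esub> q"
  have i: "?i \<in> Units K" "?i \<in> carrier K" using q by simp_all
  let ?a = "Y.gen s'" and ?c = "Y.gen \<tau>"
  have ac: "?a \<in> carrier H'" "?c \<in> carrier H'" using s' \<tau> by auto

  \<comment> \<open>The leading term of a product along \<open>u\<close>: one factor \<open>q\<inverse>\<close> for each letter \<open>t\<close>.\<close>
  have R_gen_prod: "\<exists>k\<in>Units K. \<exists>y\<in>Y.below (length (\<phi> u)).
      R (X.gen_prod u) = k \<odot>\<^bsub>H'\<^esub> Y.gen_prod (\<phi> u) \<oplus>\<^bsub>H'\<^esub> y" if "u \<in> lists S" for u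
    using that
  proof (induction u rule: list.induct)
    case Nil
    show ?case
      by (intro bexI[of _ "\<one>\<^bsub>K\<^esub>"] bexI[of _ "\<zero>\<^bsub>H'\<^esub>"]) (simp_all add: Y.below_zero)
  next
    case (Cons s u)
    have s: "s \<in> S" and u: "u \<in> lists S" using Cons.prems by auto
    then obtain k y where k: "k \<in> Units K" "k \<in> carrier K" and y: "y \<in> Y.below (length (\<phi> u))"
      and IH: "R (X.gen_prod u) = k \<odot>\<^bsub>H'\<^esub> Y.gen_prod (\<phi> u) \<oplus>\<^bsub>H'\<^esub> y"
      using Cons.IH by auto
    let ?P = "Y.gen_prod (\<phi> u)"
    have P: "?P \<in> carrier H'" "?P \<in> Y.below (Suc (length (\<phi> u)))" and yc: "y \<in> carrier H'"
      using \<phi>_in_lists[OF u] y Y.gen_prod_below Y.below_closed by auto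
    have R_step: "R (X.gen_prod (s # u)) = R (X.gen s) \<otimes>\<^bsub>H'\<^esub> (k \<odot>\<^bsub>H'\<^esub> ?P \<oplus>\<^bsub>H'\<^esub> y)"
      using s u by (simp add: IH)
    show ?case
    proof (cases "s = t")
      case False
      then have "s \<in> S - {t}" "s \<in> S'" using old_gens s by simp_all
      have "R (X.gen_prod (s # u)) = k \<odot>\<^bsub>H'\<^esub> (Y.gen s \<otimes>\<^bsub>H'\<^esub> ?P) \<oplus>\<^bsub>H'\<^esub> Y.gen s \<otimes>\<^bsub>H'\<^esub> y"
        unfolding R_step R_old[OF \<open>s \<in> S - {t}\<close>]
        using \<open>s \<in> S'\<close> P yc k by (simp add: Y.A.r_distr Y.smult_mult_right)
      then show ?thesis
        using k y Y.gen_mult_below[OF \<open>s \<in> S'\<close> y] False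
        by (intro bexI[of _ k] bexI[of _ "Y.gen s \<otimes>\<^bsub>H'\<^esub> y"]) (simp_all add: expand_def)
    next
      case True
      let ?z = "k \<odot>\<^bsub>H'\<^esub> ?P \<oplus>\<^bsub>H'\<^esub> y"
      have z: "?z \<in> carrier H'" "?z \<in> Y.below (Suc (length (\<phi> u)))"
        using P y yc k by (auto intro!: Y.below_add Y.below_smult intro: Y.below_mono)
      let ?j = "?i \<ominus>\<^bsub>K\<^esub> \<one>\<^bsub>K\<^esub>"
      have j: "?j \<in> carrier K" using i by simp
      \<comment> \<open>Lower terms: the image of \<open>y\<close>, and the summand of \<open>g\<^bsub>s'\<^esub>\<inverse>\<close> that drops the second \<open>s'\<close>.\<close>
      let ?y' = "?i \<odot>\<^bsub>H'\<^esub> (?a \<otimes>\<^bsub>H'\<^esub> (?c \<otimes>\<^bsub>H'\<^esub> (?a \<otimes>\<^bsub>H'\<^esub> y))) \<oplus>\<^bsub>H'\<^esub>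
        ?j \<odot>\<^bsub>H'\<^esub> (?a \<otimes>\<^bsub>H'\<^esub> (?c \<otimes>\<^bsub>H'\<^esub> ?z))"
      have y': "?y' \<in> Y.below (Suc (Suc (Suc (length (\<phi> u)))))"
      proof (intro Y.below_add Y.below_smult i(2) j)
        show "?a \<otimes>\<^bsub>H'\<^esub> (?c \<otimes>\<^bsub>H'\<^esub> (?a \<otimes>\<^bsub>H'\<^esub> y)) \<in> Y.below (Suc (Suc (Suc (length (\<phi> u)))))"
          by (intro Y.gen_mult_below s' \<tau> y)
        show "?a \<otimes>\<^bsub>H'\<^esub> (?c \<otimes>\<^bsub>H'\<^esub> ?z) \<in> Y.below (Suc (Suc (Suc (length (\<phi> u)))))"
          by (intro Y.gen_mult_below s' \<tau> z(2))
      qed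
      have "R (X.gen_prod (s # u)) = ?a \<otimes>\<^bsub>H'\<^esub> (?c \<otimes>\<^bsub>H'\<^esub>
          ((?i \<odot>\<^bsub>H'\<^esub> ?a \<oplus>\<^bsub>H'\<^esub> ?j \<odot>\<^bsub>H'\<^esub> \<one>\<^bsub>H'\<^esub>) \<otimes>\<^bsub>H'\<^esub> ?z))"
        unfolding R_step unfolding True R_t Y.gen_inverse[OF s' q]
        using ac z i j by (simp add: Y.A.m_assoc)
      also have "(?i \<odot>\<^bsub>H'\<^esub> ?a \<oplus>\<^bsub>H'\<^esub> ?j \<odot>\<^bsub>H'\<^esub> \<one>\<^bsub>H'\<^esub>) \<otimes>\<^bsub>H'\<^esub> ?z =
          ?i \<odot>\<^bsub>H'\<^esub> (?a \<otimes>\<^bsub>H'\<^esub> ?z) \<oplus>\<^bsub>H'\<^esub> ?j \<odot>\<^bsub>H'\<^esub> ?z"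
        using ac z i j by (simp add: Y.A.l_distr Y.smult_mult_left)
      also have "?a \<otimes>\<^bsub>H'\<^esub> (?c \<otimes>\<^bsub>H'\<^esub> (?i \<odot>\<^bsub>H'\<^esub> (?a \<otimes>\<^bsub>H'\<^esub> ?z) \<oplus>\<^bsub>H'\<^esub> ?j \<odot>\<^bsub>H'\<^esub> ?z)) =
          ?i \<odot>\<^bsub>H'\<^esub> (?a \<otimes>\<^bsub>H'\<^esub> (?c \<otimes>\<^bsub>H'\<^esub> (?a \<otimes>\<^bsub>H'\<^esub> ?z))) \<oplus>\<^bsub>H'\<^esub> ?j \<odot>\<^bsub>H'\<^esub> (?a \<otimes>\<^bsub>H'\<^esub> (?c \<otimes>\<^bsub>H'\<^esub> ?z))"
        using ac z(1) i j by (simp add: Y.A.r_distr Y.smult_mult_right)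
      also have "?i \<odot>\<^bsub>H'\<^esub> (?a \<otimes>\<^bsub>H'\<^esub> (?c \<otimes>\<^bsub>H'\<^esub> (?a \<otimes>\<^bsub>H'\<^esub> ?z))) =
          (?i \<otimes>\<^bsub>K\<^esub> k) \<odot>\<^bsub>H'\<^esub> (?a \<otimes>\<^bsub>H'\<^esub> (?c \<otimes>\<^bsub>H'\<^esub> (?a \<otimes>\<^bsub>H'\<^esub> ?P))) \<oplus>\<^bsub>H'\<^esub>
          ?i \<odot>\<^bsub>H'\<^esub> (?a \<otimes>\<^bsub>H'\<^esub> (?c \<otimes>\<^bsub>H'\<^esub> (?a \<otimes>\<^bsub>H'\<^esub> y)))"
        using ac P yc i k
        by (simp add: Y.A.r_distr Y.smult_mult_right Y.smult_r_distr Y.smult_assoc1)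
      finally have "R (X.gen_prod (s # u)) =
          (?i \<otimes>\<^bsub>K\<^esub> k) \<odot>\<^bsub>H'\<^esub> (?a \<otimes>\<^bsub>H'\<^esub> (?c \<otimes>\<^bsub>H'\<^esub> (?a \<otimes>\<^bsub>H'\<^esub> ?P))) \<oplus>\<^bsub>H'\<^esub> ?y'"
        using ac P yc i j k z by (simp add: Y.M.a_assoc)
      moreover have "?i \<otimes>\<^bsub>K\<^esub> k \<in> Units K" using i k by simp
      ultimately show ?thesis
        using y' True by (intro bexI[of _ "?i \<otimes>\<^bsub>K\<^esub> k"] bexI[of _ ?y']) (simp_all add: expand_def)
    qed
  qed

  \<comment> \<open>A reduced word for each group element; \<open>\<psi> w\<close> is then the group element leading in \<open>R (e w)\<close>.\<close>
  define rep where "rep w = (SOME u. A.reduced u \<and> w = A.cl u)" for w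
  have rep: "A.reduced (rep w) \<and> w = A.cl (rep w)" if "w \<in> carrier A.W" for w
    unfolding rep_def by (rule someI_ex) (use A.ex_reduced[OF that] in blast)
  define \<psi> where "\<psi> w = B.cl (\<phi> (rep w))" for w
  have rep_lists: "rep w \<in> lists S" if "w \<in> carrier A.W" for w
    using rep[OF that] by (simp add: A.reduced_def)
  have \<psi>_closed: "\<psi> w \<in> carrier B.W" if "w \<in> carrier A.W" for w
    unfolding \<psi>_def B.carrier_W using \<phi>_in_lists[OF rep_lists[OF that]] by (rule imageI)
  have \<psi>_inj: "v = w" if "v \<in> carrier A.W" "w \<in> carrier A.W" "\<psi> v = \<psi> w" for v w
  proof -
    have "cox_eq S' m' (\<phi> (rep v)) (\<phi> (rep w))"
      using that(3) B.cl_eq_iff[OF \<phi>_in_lists[OF rep_lists[OF that(1)]]] by (simp add: \<psi>_def)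
    then have "A.cl (rep v) = A.cl (rep w)"
      using \<phi>_inj[OF rep_lists[OF that(1)] rep_lists[OF that(2)]]
        A.cl_eq_iff[OF rep_lists[OF that(1)]] by blast
    with rep[OF that(1)] rep[OF that(2)] show ?thesis by simp
  qed
  have R_e: "\<exists>k\<in>Units K. \<exists>y\<in>Y.below (cox_length (\<psi> w)).
      R (e w) = k \<odot>\<^bsub>H'\<^esub> g (\<psi> w) \<oplus>\<^bsub>H'\<^esub> y" if w: "w \<in> carrier A.W" for w
  proof -
    have red: "A.reduced (rep w)" and eq: "w = A.cl (rep w)"
      using rep[OF w] by auto
    from red have "B.reduced (\<phi> (rep w))" by (rule reduced_\<phi>)
    then have "cox_length (\<psi> w) = length (\<phi> (rep w))" "g (\<psi> w) = Y.gen_prod (\<phi> (rep w))"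
      unfolding \<psi>_def by (rule B.cox_length_reduced, simp add: Y.gen_prod_reduced)
    moreover have "e w = X.gen_prod (rep w)"
      using X.gen_prod_reduced[OF red] eq by simp
    ultimately show ?thesis
      using R_gen_prod[OF rep_lists[OF w]] by simp
  qed

  have independent: "c w = \<zero>\<^bsub>K\<^esub>"
    if J: "finite J" "J \<subseteq> carrier A.W" "c \<in> J \<rightarrow> carrier K"
      and zero: "R (\<Oplus>\<^bsub>H\<^esub>w\<in>J. c w \<odot>\<^bsub>H\<^esub> e w) = \<zero>\<^bsub>H'\<^esub>" and w: "w \<in> J" for J c w
  proof (rule ccontr)
    assume "c w \<noteq> \<zero>\<^bsub>K\<^esub>"
    \<comment> \<open>Among the nonzero terms, take one whose leading element has maximal length.\<close>
    let ?L = "\<lambda>w. cox_length (\<psi> w)"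
    let ?N = "{w \<in> J. c w \<noteq> \<zero>\<^bsub>K\<^esub>}"
    have "finite ?N" "?N \<noteq> {}" using J w \<open>c w \<noteq> \<zero>\<^bsub>K\<^esub>\<close> by auto
    then have "Max (?L ` ?N) \<in> ?L ` ?N" by (intro Max_in) simp_all
    then obtain v where "v \<in> ?N" and Lv: "?L v = Max (?L ` ?N)" by force
    have max: "?L w \<le> ?L v" if "w \<in> ?N" for w
      unfolding Lv using \<open>finite ?N\<close> that by simp
    have v: "v \<in> J" "c v \<noteq> \<zero>\<^bsub>K\<^esub>" "v \<in> carrier A.W"
      using \<open>v \<in> ?N\<close> J by auto
    \<comment> \<open>All that is left besides the leading term of \<open>v\<close> avoids the basis element at \<open>\<psi> v\<close>.\<close>
    define A where "A = carrier B.W - {\<psi> v}"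
    have A: "A \<subseteq> carrier B.W" by (auto simp: A_def)
    have below: "x \<in> Y.std_span A" if "x \<in> Y.below (?L v)" for x
      using that unfolding Y.below_def by (rule Y.std_span_mono) (auto simp: A_def)
    have cJ: "\<And>w. w \<in> J \<Longrightarrow> c w \<in> carrier K \<and> e w \<in> carrier H" using J by auto
    have summand: "R (c w \<odot>\<^bsub>H\<^esub> e w) \<in> Y.std_span A" if "w \<in> J - {v}" for w
    proof (cases "c w = \<zero>\<^bsub>K\<^esub>")
      case True
      then show ?thesis using cJ that Y.std_span.zero by simp
    next
      case False
      have wW: "w \<in> carrier A.W" "w \<noteq> v" using that J by auto
      obtain k y where ky: "k \<in> Units K" "k \<in> carrier K" "y \<in> Y.below (?L w)"
        "R (e w) = k \<odot>\<^bsub>H'\<^esub> g (\<psi> w) \<oplus>\<^bsub>H'\<^esub> y"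
        using R_e[OF wW(1)] by blast
      have "\<psi> w \<in> A" using \<psi>_inj[of w v] \<psi>_closed wW v by (auto simp: A_def)
      moreover have "y \<in> Y.std_span A"
        using max[of w] that False ky(3) by (intro below) (auto intro: Y.below_mono)
      ultimately have "R (e w) \<in> Y.std_span A"
        unfolding ky(4) using ky(2) by (intro Y.std_span.add)
      then show ?thesis
        using R_smult cJ that A Y.std_span_smult by simp
    qed
    have rest: "R (\<Oplus>\<^bsub>H\<^esub>w\<in>J'. c w \<odot>\<^bsub>H\<^esub> e w) \<in> Y.std_span A" if "finite J'" "J' \<subseteq> J - {v}" for J'
      using that
    proof (induction J' rule: finite_induct)
      case empty
      then show ?case using Y.std_span.zero by simp
    next
      case (insert w J')
      then have "(\<Oplus>\<^bsub>H\<^esub>w\<in>insert w J'. c w \<odot>\<^bsub>H\<^esub> e w) =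
          c w \<odot>\<^bsub>H\<^esub> e w \<oplus>\<^bsub>H\<^esub> (\<Oplus>\<^bsub>H\<^esub>w\<in>J'. c w \<odot>\<^bsub>H\<^esub> e w)"
        using cJ by (intro X.M.finsum_insert) auto
      moreover have "(\<Oplus>\<^bsub>H\<^esub>w\<in>J'. c w \<odot>\<^bsub>H\<^esub> e w) \<in> carrier H"
        using cJ insert by (intro X.M.finsum_closed) auto
      ultimately show ?case
        using insert cJ summand[of w] A by (simp add: Y.std_span_add)
    qed
    let ?r = "\<Oplus>\<^bsub>H\<^esub>w\<in>J - {v}. c w \<odot>\<^bsub>H\<^esub> e w"
    have r: "?r \<in> carrier H" "R ?r \<in> Y.std_span A"
      using cJ rest[of "J - {v}"] J(1) by (auto intro!: X.M.finsum_closed)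
    obtain k y where ky: "k \<in> Units K" "k \<in> carrier K" "y \<in> Y.below (?L v)"
      "R (e v) = k \<odot>\<^bsub>H'\<^esub> g (\<psi> v) \<oplus>\<^bsub>H'\<^esub> y"
      using R_e[OF v(3)] by blast
    have y: "y \<in> carrier H'" "y \<in> Y.std_span A" using ky(3) Y.below_closed below by auto
    have cv: "c v \<in> carrier K" "e v \<in> carrier H" using cJ v by auto
    have "(\<Oplus>\<^bsub>H\<^esub>w\<in>J. c w \<odot>\<^bsub>H\<^esub> e w) = (\<Oplus>\<^bsub>H\<^esub>w\<in>insert v (J - {v}). c w \<odot>\<^bsub>H\<^esub> e w)"
      using v(1) by (simp add: insert_absorb)
    also have "\<dots> = c v \<odot>\<^bsub>H\<^esub> e v \<oplus>\<^bsub>H\<^esub> ?r"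
      using cJ cv J(1) by (intro X.M.finsum_insert) auto
    finally have "\<zero>\<^bsub>H'\<^esub> = c v \<odot>\<^bsub>H'\<^esub> (k \<odot>\<^bsub>H'\<^esub> g (\<psi> v) \<oplus>\<^bsub>H'\<^esub> y) \<oplus>\<^bsub>H'\<^esub> R ?r"
      using zero cv r R_smult ky(4) by simp
    also have "\<dots> = (c v \<otimes>\<^bsub>K\<^esub> k) \<odot>\<^bsub>H'\<^esub> g (\<psi> v) \<oplus>\<^bsub>H'\<^esub> (c v \<odot>\<^bsub>H'\<^esub> y \<oplus>\<^bsub>H'\<^esub> R ?r)"
      using cv ky(2) y r \<psi>_closed[OF v(3)]
      by (simp add: Y.smult_r_distr Y.smult_assoc1 Y.M.a_assoc)
    finally have "c v \<otimes>\<^bsub>K\<^esub> k = \<zero>\<^bsub>K\<^esub>"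
      using cv ky(2) y r A \<psi>_closed[OF v(3)]
      by (intro Y.leading_coefficient_zero[of "c v \<odot>\<^bsub>H'\<^esub> y \<oplus>\<^bsub>H'\<^esub> R ?r" A "\<psi> v"])
        (auto intro!: Y.std_span_add Y.std_span_smult simp: A_def)
    moreover have "c v = (c v \<otimes>\<^bsub>K\<^esub> k) \<otimes>\<^bsub>K\<^esub> inv\<^bsub>K\<^esub> k"
      using cv ky(1,2) by (simp add: X.R.m_assoc)
    ultimately show False using ky(1) v(2) by simp
  qed

  have kernel: "x = \<zero>\<^bsub>H\<^esub>" if x: "x \<in> carrier H" "R x = \<zero>\<^bsub>H'\<^esub>" for x
  proof -
    have "\<exists>J c. finite J \<and> J \<subseteq> carrier A.W \<and> c \<in> J \<rightarrow> carrier K \<and> x = (\<Oplus>\<^bsub>H\<^esub>w\<in>J. c w \<odot>\<^bsub>H\<^esub> e w)"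
      using X.basis unfolding is_basis_def by (elim conjE bspec[OF _ x(1)])
    then obtain J c where J: "finite J" "J \<subseteq> carrier A.W" "c \<in> J \<rightarrow> carrier K"
      and x_eq: "x = (\<Oplus>\<^bsub>H\<^esub>w\<in>J. c w \<odot>\<^bsub>H\<^esub> e w)"
      by (elim exE conjE)
    have "c w \<odot>\<^bsub>H\<^esub> e w = \<zero>\<^bsub>H\<^esub>" if "w \<in> J" for w
    proof -
      have "c w = \<zero>\<^bsub>K\<^esub>"
        using independent[OF J x(2)[unfolded x_eq] that] .
      moreover have "w \<in> carrier A.W" using J(2) that by (rule subsetD)
      ultimately show ?thesis by simp
    qed
    then have "x = (\<Oplus>\<^bsub>H\<^esub>w\<in>J. \<zero>\<^bsub>H\<^esub>)"
      unfolding x_eq by (intro X.M.finsum_cong') auto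
    then show ?thesis by simp
  qed
  show ?thesis
  proof (rule inj_onI)
    fix x y assume xy: "x \<in> carrier H" "y \<in> carrier H" "R x = R y"
    then have "R (x \<ominus>\<^bsub>H\<^esub> y) = \<zero>\<^bsub>H'\<^esub>"
      by (simp add: a_minus_def Y.M.r_neg)
    then have "x \<ominus>\<^bsub>H\<^esub> y = \<zero>\<^bsub>H\<^esub>" using kernel xy by simp
    then show "x = y" using xy X.A.r_right_minus_eq by simp
  qed
qed


section \<open>The towers\<close>

theorem theorem3p2:
  fixes K :: "('k, 'p) ring_scheme" and q :: 'k
  assumes "cring K" and "q \<in> Units K"
  shows "(\<forall>n\<ge>2. \<forall>(H :: ('k, 'a) module) e (H' :: ('k, 'b) module) g R.
            hecke_C K q n H e \<and> hecke_C K q (n+1) H' g \<and> is_R K n H e H' g R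
            \<longrightarrow> inj_on R (carrier H))
       \<and> (\<forall>n\<ge>3. \<forall>(H :: ('k, 'a) module) e (H' :: ('k, 'b) module) g Q.
            hecke_B K q n H e \<and> hecke_B K q (n+1) H' g \<and> is_Q K n H e H' g Q
            \<longrightarrow> inj_on Q (carrier H))"
proof (intro conjI allI impI; elim conjE)
  fix n :: nat and H :: "('k, 'a) module" and e and H' :: "('k, 'b) module" and g R
  assume n: "2 \<le> n" and H: "hecke_C K q n H e" and H': "hecke_C K q (n + 1) H' g"
    and R: "is_R K n H e H' g R"
  have "s \<in> Sig ` {0..n - 1}" if "s \<in> C_gens n - {T n}" for s
    using that by (auto simp: C_gens_def)
  then show "inj_on R (carrier H)"
    using R unfolding is_R_def
    by (intro faithful_coxeter_tower.hecke_hom_inj_on[OF faithful_coxeter_tower_C[OF n] H H' assms(2)]) auto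
next
  fix n :: nat and H :: "('k, 'a) module" and e and H' :: "('k, 'b) module" and g Q
  assume n: "3 \<le> n" and H: "hecke_B K q n H e" and H': "hecke_B K q (n + 1) H' g"
    and Q: "is_Q K n H e H' g Q"
  have "s \<in> Sig ` {1..n - 1} \<union> {SigBar}" if "s \<in> B_gens n - {T n}" for s
    using that by (auto simp: B_gens_def)
  then show "inj_on Q (carrier H)"
    using Q unfolding is_Q_def
    by (intro faithful_coxeter_tower.hecke_hom_inj_on[OF faithful_coxeter_tower_B[OF n] H H' assms(2)]) blast+
qed

end
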